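(* Let $q,r$ be constants. Any $n$-variable instance of $(q,r)$-CSP-with-Wildcard can be solved (an assignment of minimum total cost can be found) in time $\left((q+1)^r-1\right)^{n/r}\cdot n^{\mathcal{O}(1)}$.
   Context: Let $\times$ be a special symbol. For a set $X$, let $\mathcal{F}_q(X)$ be the set of all functions $f:X\to[q]\cup\{\times\}$, and $\|f\|=|f^{-1}(\times)|$. For $f,f'\in\mathcal{F}_q(X)$ write $f'\preceq f$ if for all $x\in X$ either $f(x)=f'(x)$ or $f(x)=\times$. An instance of $(q,r)$-CSP-with-Wildcard is a triple $(\mathcal{V},\mathcal{C},\mathrm{cost})$ where $\mathcal{V}$ is a finite set of variables with domain $[q]\cup\{\times\}$, $\mathcal{C}$ is a multiset of subsets of $\mathcal{V}$ each of size at most $r$, and $\mathrm{cost}$ assigns to each pair $(C,f)$ with $C\in\mathcal{C}$, $f\in\mathcal{F}_q(C)$ a non-negative integer, satisfying the wildcard property: for all $C\in\mathcal{C}$ and $f,f'\in\mathcal{F}_q(C)$ with $f'\preceq f$, $\mathrm{cost}(C,f)\le\mathrm{cost}(C,f')$. The task is to find $\varphi:\mathcal{V}\to[q]\cup\{\times\}$ minimizing $\|\varphi\|+\sum_{C\in\mathcal{C}}\mathrm{cost}(C,\varphi|_C)$. *)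

theory Defs
  imports Complex_Main "HOL-Library.Multiset" "HOL-Library.FuncSet"
begin

section \<open>CSP with wildcard\<close>

text \<open>The wildcard symbol is \<^term>\<open>None\<close>; the value $i \in [q]$ is \<open>Some i\<close>. Functions on a set
  \<open>X\<close> are extensional, so that they are determined by their values on \<open>X\<close>.\<close>

definition wvalues :: "nat \<Rightarrow> nat option set" where
  "wvalues q = insert None (Some ` {1..q})"

definition wfuns :: "nat \<Rightarrow> nat set \<Rightarrow> (nat \<Rightarrow> nat option) set" where
  "wfuns q X = (X \<rightarrow>\<^sub>E wvalues q)"

definition wnorm :: "nat set \<Rightarrow> (nat \<Rightarrow> nat option) \<Rightarrow> nat" where
  "wnorm X f = card {x \<in> X. f x = None}"

definition wle :: "nat set \<Rightarrow> (nat \<Rightarrow> nat option) \<Rightarrow> (nat \<Rightarrow> nat option) \<Rightarrow> bool" where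
  "wle X f' f \<longleftrightarrow> (\<forall>x\<in>X. f x = f' x \<or> f x = None)"

record wcsp =
  Vars :: "nat set"
  Constraints :: "nat set multiset"
  Cost :: "nat set \<Rightarrow> (nat \<Rightarrow> nat option) \<Rightarrow> nat"

definition wcsp_instance :: "nat \<Rightarrow> nat \<Rightarrow> wcsp \<Rightarrow> bool" where
  "wcsp_instance q r I \<longleftrightarrow>
     finite (Vars I) \<and>
     (\<forall>C \<in># Constraints I. C \<subseteq> Vars I \<and> card C \<le> r) \<and>
     (\<forall>C \<in># Constraints I. \<forall>f \<in> wfuns q C. \<forall>f' \<in> wfuns q C.
        wle C f' f \<longrightarrow> Cost I C f \<le> Cost I C f')"

definition total_cost :: "wcsp \<Rightarrow> (nat \<Rightarrow> nat option) \<Rightarrow> nat" where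
  "total_cost I \<phi> =
     wnorm (Vars I) \<phi> + (\<Sum>C \<in># Constraints I. Cost I C (restrict \<phi> C))"

definition optimal :: "nat \<Rightarrow> wcsp \<Rightarrow> (nat \<Rightarrow> nat option) \<Rightarrow> bool" where
  "optimal q I \<phi> \<longleftrightarrow>
     \<phi> \<in> wfuns q (Vars I) \<and> (\<forall>\<psi> \<in> wfuns q (Vars I). total_cost I \<phi> \<le> total_cost I \<psi>)"

section \<open>Word RAM\<close>

text \<open>A random access machine with registers and an indirectly addressed memory, programmed with
  structured control flow. The parameter \<open>W\<close> is the word bound ($2^w$ for word length $w$): every
  number computed must be below \<open>W\<close>. An expression that overflows has no value, and a program that
  evaluates it has no execution. Each node of an expression and each command costs one time unit.\<close>

datatype arith = Plus | Monus | Times | Quot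

fun arith_fun :: "arith \<Rightarrow> nat \<Rightarrow> nat \<Rightarrow> nat" where
  "arith_fun Plus a b = a + b"
| "arith_fun Monus a b = a - b"
| "arith_fun Times a b = a * b"
| "arith_fun Quot a b = a div b"

datatype expr = Num nat | Reg nat | Mem expr | Op arith expr expr

datatype prog =
    Skip
  | Assign nat expr
  | Store expr expr
  | Seq prog prog
  | Cond expr prog prog
  | While expr prog

record ram =
  regs :: "nat \<Rightarrow> nat"
  mem :: "nat \<Rightarrow> nat"

definition word :: "nat \<Rightarrow> nat \<Rightarrow> nat option" where
  "word W k = (if k < W then Some k else None)"

fun eval :: "nat \<Rightarrow> ram \<Rightarrow> expr \<Rightarrow> nat option" where
  "eval W s (Num k) = word W k"
| "eval W s (Reg x) = word W (regs s x)"
| "eval W s (Mem e) = Option.bind (eval W s e) (\<lambda>a. word W (mem s a))"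
| "eval W s (Op f e1 e2) =
     Option.bind (eval W s e1) (\<lambda>a. Option.bind (eval W s e2) (\<lambda>b. word W (arith_fun f a b)))"

fun etime :: "expr \<Rightarrow> nat" where
  "etime (Num k) = 1"
| "etime (Reg x) = 1"
| "etime (Mem e) = 1 + etime e"
| "etime (Op f e1 e2) = 1 + etime e1 + etime e2"

text \<open>\<open>exec W p s t s'\<close>: with word bound \<open>W\<close>, program \<open>p\<close> started in \<open>s\<close> halts in \<open>s'\<close> after
  exactly \<open>t\<close> time units. Tests succeed on nonzero values.\<close>

inductive exec :: "nat \<Rightarrow> prog \<Rightarrow> ram \<Rightarrow> nat \<Rightarrow> ram \<Rightarrow> bool" for W :: nat where
  Skip: "exec W Skip s 1 s"
| Assign: "eval W s e = Some v \<Longrightarrow>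
    exec W (Assign x e) s (1 + etime e) (s\<lparr>regs := (regs s)(x := v)\<rparr>)"
| Store: "eval W s e1 = Some a \<Longrightarrow> eval W s e2 = Some v \<Longrightarrow>
    exec W (Store e1 e2) s (1 + etime e1 + etime e2) (s\<lparr>mem := (mem s)(a := v)\<rparr>)"
| Seq: "exec W p1 s t1 s' \<Longrightarrow> exec W p2 s' t2 s'' \<Longrightarrow>
    exec W (Seq p1 p2) s (1 + t1 + t2) s''"
| CondTrue: "eval W s e = Some v \<Longrightarrow> v \<noteq> 0 \<Longrightarrow> exec W p1 s t s' \<Longrightarrow>
    exec W (Cond e p1 p2) s (1 + etime e + t) s'"
| CondFalse: "eval W s e = Some 0 \<Longrightarrow> exec W p2 s t s' \<Longrightarrow>
    exec W (Cond e p1 p2) s (1 + etime e + t) s'"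
| WhileFalse: "eval W s e = Some 0 \<Longrightarrow>
    exec W (While e p) s (1 + etime e) s"
| WhileTrue: "eval W s e = Some v \<Longrightarrow> v \<noteq> 0 \<Longrightarrow> exec W p s t1 s' \<Longrightarrow>
    exec W (While e p) s' t2 s'' \<Longrightarrow>
    exec W (While e p) s (1 + etime e + t1 + t2) s''"

inductive_cases exec_SkipE: "exec W Skip s t s'"
inductive_cases exec_AssignE: "exec W (Assign x e) s t s'"
inductive_cases exec_StoreE: "exec W (Store e1 e2) s t s'"
inductive_cases exec_SeqE: "exec W (Seq p1 p2) s t s'"
inductive_cases exec_CondE: "exec W (Cond e p1 p2) s t s'"
inductive_cases exec_WhileE: "exec W (While e p) s t s'"

lemma exec_deterministic:
  "exec W p s t s1 \<Longrightarrow> exec W p s u s2 \<Longrightarrow> t = u \<and> s1 = s2"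
proof (induction arbitrary: u s2 rule: exec.induct)
  case (Skip s) then show ?case by (auto elim: exec_SkipE)
next
  case (Assign s e v x) then show ?case by (auto elim!: exec_AssignE)
next
  case (Store s e1 a e2 v) then show ?case by (auto elim!: exec_StoreE)
next
  case (Seq p1 s t1 s' p2 t2 s'')
  obtain u1 r u2 where "u = Suc (u1 + u2)" "exec W p1 s u1 r" "exec W p2 r u2 s2"
    using Seq.prems by (rule exec_SeqE)
  then show ?case using Seq.IH(1)[of u1 r] Seq.IH(2)[of u2 s2] by simp
next
  case (CondTrue s e v p1 t s' p2)
  from CondTrue.prems obtain u1 where "u = Suc (etime e + u1)" "exec W p1 s u1 s2"
    by (rule exec_CondE) (use CondTrue.hyps in simp_all)
  then show ?case using CondTrue.IH[of u1 s2] by simp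
next
  case (CondFalse s e p2 t s' p1)
  from CondFalse.prems obtain u1 where "u = Suc (etime e + u1)" "exec W p2 s u1 s2"
    by (rule exec_CondE) (use CondFalse.hyps in simp_all)
  then show ?case using CondFalse.IH[of u1 s2] by simp
next
  case (WhileFalse s e p)
  from WhileFalse.prems show ?case by (rule exec_WhileE) (use WhileFalse.hyps in simp_all)
next
  case (WhileTrue s e v p t1 s' t2 s'')
  from WhileTrue.prems obtain u1 r u2 where
    "u = Suc (etime e + u1 + u2)" "exec W p s u1 r" "exec W (While e p) r u2 s2"
    by (rule exec_WhileE) (use WhileTrue.hyps in simp_all)
  then show ?case using WhileTrue.IH(1)[of u1 r] WhileTrue.IH(2)[of u2 s2] by simp
qed

section \<open>Input and output\<close>

text \<open>Lexicographic enumeration of the functions on the variables of a list, with the wildcard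
  as first value.\<close>

fun assignments :: "nat \<Rightarrow> nat list \<Rightarrow> (nat \<Rightarrow> nat option) list" where
  "assignments q [] = [\<lambda>_. undefined]"
| "assignments q (x # xs) =
     concat (map (\<lambda>a. map (\<lambda>f. f(x := a)) (assignments q xs)) (None # map Some [1..<Suc q]))"

lemma set_assignments: "distinct xs \<Longrightarrow> set (assignments q xs) = wfuns q (set xs)"
proof (induction xs)
  case Nil then show ?case by (simp add: wfuns_def)
next
  case (Cons x xs)
  have v: "set (None # map Some [1..<Suc q]) = wvalues q"
    by (auto simp: wvalues_def)
  have "set (assignments q (x # xs)) =
        (\<Union>a \<in> wvalues q. (\<lambda>f. f(x := a)) ` wfuns q (set xs))"
    using Cons by (simp only: assignments.simps set_concat set_map v[symmetric]) auto
  also have "\<dots> = wfuns q (set (x # xs))"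
    by (simp add: wfuns_def PiE_insert_eq) (force simp: image_iff)
  finally show ?case .
qed

text \<open>An instance is written as a list of words, given an enumeration \<open>vs\<close> of its variables and
  an enumeration \<open>cs\<close> of its distinct constraints. As the cost depends only on the set \<open>C\<close>, equal
  constraints are listed once, together with their multiplicity; thus the input consists of
  $n^{O(1)}$ words for fixed \<open>q\<close> and \<open>r\<close>, however large the multiplicities and costs are.\<close>

definition encode_constraint :: "nat \<Rightarrow> wcsp \<Rightarrow> nat list \<Rightarrow> nat set \<Rightarrow> nat list" where
  "encode_constraint q I vs C =
     (let ys = filter (\<lambda>v. v \<in> C) vs
      in [length ys, count (Constraints I) C] @ ys @ map (Cost I C) (assignments q ys))"

definition encode :: "nat \<Rightarrow> wcsp \<Rightarrow> nat list \<Rightarrow> nat set list \<Rightarrow> nat list" where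
  "encode q I vs cs =
     [length vs, length cs] @ vs @ concat (map (encode_constraint q I vs) cs)"

definition input_encoding :: "nat \<Rightarrow> wcsp \<Rightarrow> nat list \<Rightarrow> nat list \<Rightarrow> bool" where
  "input_encoding q I vs xs \<longleftrightarrow>
     distinct vs \<and> set vs = Vars I \<and>
     (\<exists>cs. distinct cs \<and> set cs = set_mset (Constraints I) \<and> xs = encode q I vs cs)"

definition initial :: "nat list \<Rightarrow> ram" where
  "initial xs = \<lparr>regs = (\<lambda>_. 0), mem = (\<lambda>i. if i < length xs then xs ! i else 0)\<rparr>"

text \<open>The word length is $O(n + \log M)$, where \<open>M\<close> is the largest input number, so that
  input numbers, and addresses into a memory of size $2^{O(n)}$, fit into a word.\<close>

definition word_bound :: "nat \<Rightarrow> nat \<Rightarrow> nat list \<Rightarrow> nat" where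
  "word_bound k n xs = (2 ^ n * (Max (set xs) + 2)) ^ k"

text \<open>On halting, cell \<open>i\<close> holds the value of the \<open>i\<close>-th variable, with 0 for the wildcard.\<close>

definition output_represents :: "nat list \<Rightarrow> ram \<Rightarrow> (nat \<Rightarrow> nat option) \<Rightarrow> bool" where
  "output_represents vs s \<phi> \<longleftrightarrow>
     (\<forall>i < length vs. mem s i = (case \<phi> (vs ! i) of None \<Rightarrow> 0 | Some a \<Rightarrow> a))"

definition solves_wcsp_in_time :: "prog \<Rightarrow> nat \<Rightarrow> nat \<Rightarrow> nat \<Rightarrow> (nat \<Rightarrow> real) \<Rightarrow> bool" where
  "solves_wcsp_in_time p k q r T \<longleftrightarrow>
     (\<forall>I vs xs. wcsp_instance q r I \<and> input_encoding q I vs xs \<longrightarrow>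
        (\<exists>t s \<phi>. exec (word_bound k (card (Vars I)) xs) p (initial xs) t s \<and>
                 real t \<le> T (card (Vars I)) \<and>
                 optimal q I \<phi> \<and> output_represents vs s \<phi>))"

end

theory Submission imports Defs begin

text \<open>Fix some variables and look at a constraint \<open>C\<close>. Enumerate the assignments of \<open>C\<close> that agree with
  the fixed values in the order of the cost table, in which the wildcard comes first. If their costs
  are not all equal, let \<open>f\<close> be the first one whose cost differs from that of the very first one.
  Turning some non-wildcard value of \<open>f\<close> on a free variable into a wildcard gives an earlier
  assignment, so by the wildcard property and by integrality this lowers the cost by at least 1,
  which pays for the wildcard. Hence \<open>f\<close> can be discarded, and branching on the \<open>u\<close> free variables of
  \<open>C\<close> yields at most \<open>(q + 1)\<^sup>u - 1\<close> children. If all constraints have constant cost, giving every free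
  variable the value 1 is optimal. The depth-first search that results visits at most
  \<open>b\<^sup>n (n + 1)\<close> nodes for \<open>b = ((q + 1)\<^sup>r - 1)\<^bsup>1/r\<^esup>\<close>, and it is carried out by a word RAM program
  with polynomial overhead per node and polynomially many memory cells.\<close>

section \<open>Lists and numbers\<close>

lemma add_le_power: "m + k \<le> (m + 2) ^ (k + 1)" for m k :: nat
proof (induction k)
  case (Suc k)
  have "1 \<le> (m + 2) ^ (k + 1)" by (rule one_le_power) simp
  then have "m + Suc k \<le> 2 * (m + 2) ^ (k + 1)" using Suc by linarith
  also have "\<dots> \<le> (m + 2) * (m + 2) ^ (k + 1)" by (intro mult_le_mono1) simp
  finally show ?case by simp
qed simp

lemma card_small_subsets_le:
  assumes V: "finite V" and S: "S \<subseteq> {C. C \<subseteq> V \<and> card C \<le> r}"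
  shows "card S \<le> (card V + 1) ^ r"
proof -
  let ?L = "{l. set l \<subseteq> insert None (Some ` V) \<and> length l = r}"
  let ?g = "\<lambda>l. {v. Some v \<in> set l}"
  have fin: "finite ?L" using V by (intro finite_lists_length_eq) auto
  have "C \<in> ?g ` ?L" if "C \<in> S" for C
  proof -
    have C: "C \<subseteq> V" "card C \<le> r" using that S by auto
    obtain l where l: "set l = C" "distinct l"
      using finite_distinct_list[OF finite_subset[OF C(1) V]] by blast
    let ?l = "map Some l @ replicate (r - card C) None"
    have "?l \<in> ?L" using C l distinct_card[of l] by auto
    moreover have "?g ?l = C" using l by auto
    ultimately show ?thesis by blast
  qed
  then have "card S \<le> card (?g ` ?L)" using fin by (intro card_mono) auto
  also have "\<dots> \<le> card ?L" by (rule card_image_le[OF fin])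
  also have "\<dots> = card (insert None (Some ` V)) ^ r" using V by (intro card_lists_length_eq) auto
  also have "card (insert None (Some ` V)) = card V + 1"
    using V by (simp add: card_insert_if card_image)
  finally show ?thesis .
qed

lemma find_append:
  "List.find P (xs @ ys) = (case List.find P xs of None \<Rightarrow> List.find P ys | Some x \<Rightarrow> Some x)"
  by (induction xs) auto

lemma find_SomeE:
  assumes "List.find P xs = Some x"
  obtains ys zs where "xs = ys @ x # zs" "P x" "\<forall>y\<in>set ys. \<not> P y"
proof -
  from assms obtain i where i: "i < length xs" "P (xs ! i)" "x = xs ! i" "\<forall>j<i. \<not> P (xs ! j)"
    by (auto simp: find_Some_iff)
  show thesis
  proof (rule that)
    show "xs = take i xs @ x # drop (Suc i) xs" using i by (simp add: id_take_nth_drop)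
    show "\<forall>y\<in>set (take i xs). \<not> P y" using i by (auto simp: in_set_conv_nth)
  qed (use i in simp)
qed

lemma sorted_wrt_concat_map:
  "sorted_wrt P (concat (map f xs)) \<longleftrightarrow>
     (\<forall>x\<in>set xs. sorted_wrt P (f x)) \<and>
     sorted_wrt (\<lambda>x y. \<forall>u\<in>set (f x). \<forall>v\<in>set (f y). P u v) xs"
  by (induction xs) (auto simp: sorted_wrt_append)

lemma sorted_wrt_irrefl_distinct:
  "sorted_wrt R xs \<Longrightarrow> (\<And>x. \<not> R x x) \<Longrightarrow> distinct xs"
  by (induction xs) auto

lemma nth_concat_map_offset:
  assumes "j < length xs" "k < length (f (xs ! j))"
  shows "concat (map f xs) ! ((\<Sum>i<j. length (f (xs ! i))) + k) = f (xs ! j) ! k"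
  using assms
proof (induction xs arbitrary: j)
  case (Cons x xs)
  show ?case
  proof (cases j)
    case (Suc i)
    then have "(\<Sum>i<j. length (f ((x # xs) ! i))) = length (f x) + (\<Sum>j<i. length (f (xs ! j)))"
      by (simp add: sum.lessThan_Suc_shift del: sum.lessThan_Suc)
    then show ?thesis using Cons.prems Cons.IH[of i] Suc by (simp add: nth_append)
  qed (use Cons.prems in \<open>simp add: nth_append\<close>)
qed simp

lemma nth_concat_map_uniform:
  assumes len: "\<And>y. length (f y) = k" and e: "e < length xs * k"
  shows "concat (map f xs) ! e = f (xs ! (e div k)) ! (e mod k)"
proof -
  have k: "e mod k < k" using e by (cases "k = 0") auto
  have "e div k < length xs" using e by (simp add: less_mult_imp_div_less)
  moreover have "(\<Sum>i<e div k. length (f (xs ! i))) + e mod k = e" by (simp add: len)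
  ultimately show ?thesis
    using nth_concat_map_offset[of "e div k" xs "e mod k" f] k by (simp add: len)
qed

lemma sum_mset_count:
  fixes f :: "'a \<Rightarrow> 'b :: comm_semiring_1"
  shows "(\<Sum>x\<in>#M. f x) = (\<Sum>x\<in>set_mset M. of_nat (count M x) * f x)"
proof (induction M)
  case (add y M)
  have "(\<Sum>x\<in>insert y (set_mset M). of_nat (count (add_mset y M) x) * f x) =
      (\<Sum>x\<in>insert y (set_mset M). of_nat (count M x) * f x + (if x = y then f x else 0))"
    by (intro sum.cong) (auto simp: algebra_simps)
  also have "\<dots> = (\<Sum>x\<in>insert y (set_mset M). of_nat (count M x) * f x) + f y"
    by (subst sum.distrib) (simp add: sum.delta)
  also have "(\<Sum>x\<in>insert y (set_mset M). of_nat (count M x) * f x) = (\<Sum>x\<in>#M. f x)"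
    unfolding add by (intro sum.mono_neutral_right) (auto simp: not_in_iff)
  finally show ?case by (simp add: add.commute)
qed simp

definition first_deviation :: "('a \<Rightarrow> 'b) \<Rightarrow> 'a list \<Rightarrow> 'a option" where
  "first_deviation f xs = List.find (\<lambda>x. f x \<noteq> f (hd xs)) xs"

definition drop_deviation :: "('a \<Rightarrow> 'b) \<Rightarrow> 'a list \<Rightarrow> 'a list" where
  "drop_deviation f xs = (case first_deviation f xs of None \<Rightarrow> xs | Some x \<Rightarrow> remove1 x xs)"

lemma first_deviation_Nil [simp]: "first_deviation f [] = None"
  by (simp add: first_deviation_def)

lemma first_deviation_in_set: "first_deviation f xs = Some x \<Longrightarrow> x \<in> set xs"
  by (auto simp: first_deviation_def find_Some_iff)

lemma first_deviation_NoneD: "first_deviation f xs = None \<Longrightarrow> x \<in> set xs \<Longrightarrow> f x = f (hd xs)"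
  by (auto simp: first_deviation_def find_None_iff)

lemma first_deviation_snoc:
  "first_deviation f (xs @ [x]) = (case first_deviation f xs of
     None \<Rightarrow> if xs \<noteq> [] \<and> f x \<noteq> f (hd xs) then Some x else None
   | Some y \<Rightarrow> Some y)"
  by (cases xs) (auto simp: first_deviation_def find_append split: option.split)

lemma drop_deviation_Nil [simp]: "drop_deviation f [] = []"
  by (simp add: drop_deviation_def)

lemma set_drop_deviation_subset: "set (drop_deviation f xs) \<subseteq> set xs"
  by (simp add: drop_deviation_def set_remove1_subset split: option.split)

lemma length_drop_deviation_le: "length (drop_deviation f xs) \<le> length xs"
  by (auto simp: drop_deviation_def length_remove1 split: option.split)

lemma drop_deviation_snoc:
  assumes "x \<notin> set xs"
  shows "drop_deviation f (xs @ [x]) =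
    (if xs \<noteq> [] \<and> first_deviation f xs = None \<and> f x \<noteq> f (hd xs)
     then drop_deviation f xs else drop_deviation f xs @ [x])"
  using assms first_deviation_in_set[of f xs]
  by (auto simp: drop_deviation_def first_deviation_snoc remove1_append remove1_idem
      split: option.split)

section \<open>Cost tables\<close>

definition symbol_code :: "nat option \<Rightarrow> nat" where
  "symbol_code a = (case a of None \<Rightarrow> 0 | Some x \<Rightarrow> x)"

lemma symbol_code_simps [simp]: "symbol_code None = 0" "symbol_code (Some x) = x"
  by (simp_all add: symbol_code_def)

lemma symbol_code_le: "a \<in> wvalues q \<Longrightarrow> symbol_code a \<le> q"
  by (auto simp: wvalues_def)

lemma symbol_code_inj: "a \<in> wvalues q \<Longrightarrow> b \<in> wvalues q \<Longrightarrow> symbol_code a = symbol_code b \<longleftrightarrow> a = b"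
  by (auto simp: wvalues_def)

lemma card_wvalues: "card (wvalues q) = q + 1"
  by (simp add: wvalues_def card_insert_if card_image)

lemma wfuns_upd_wildcard: "f \<in> wfuns q X \<Longrightarrow> v \<in> X \<Longrightarrow> f(v := None) \<in> wfuns q X"
  by (auto simp: wfuns_def wvalues_def PiE_iff extensional_def)

lemma restrict_wfuns: "f \<in> wfuns q X \<Longrightarrow> Y \<subseteq> X \<Longrightarrow> restrict f Y \<in> wfuns q Y"
  by (auto simp: wfuns_def PiE_iff)

lemma length_assignments: "length (assignments q xs) = (q + 1) ^ length xs"
  by (induction xs) (simp_all add: length_concat comp_def sum_list_triv)

lemma sorted_wrt_assignments:
  assumes "distinct xs"
  shows "sorted_wrt (\<lambda>f g. \<exists>x\<in>set xs. symbol_code (f x) < symbol_code (g x)) (assignments q xs)"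
  using assms
proof (induction xs)
  case (Cons x xs)
  have "sorted_wrt (\<lambda>a b. symbol_code a < symbol_code b) (None # map Some [1..<Suc q])"
    by (auto simp: sorted_wrt_map simp del: upt_Suc)
  moreover have "sorted_wrt (\<lambda>f g. \<exists>y\<in>set (x # xs). symbol_code (f y) < symbol_code (g y))
      (map (\<lambda>f. f(x := a)) (assignments q xs))" for a
    unfolding sorted_wrt_map using Cons.prems
    by (intro sorted_wrt_mono_rel[OF _ Cons.IH]) auto
  ultimately show ?case
    unfolding assignments.simps sorted_wrt_concat_map
    by (auto elim!: sorted_wrt_mono_rel[rotated] simp del: upt_Suc)
qed simp

lemma distinct_assignments: "distinct xs \<Longrightarrow> distinct (assignments q xs)"
  by (rule sorted_wrt_irrefl_distinct[OF sorted_wrt_assignments]) auto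

lemma nth_assignments_Cons:
  assumes "e < (q + 1) ^ Suc (length xs)"
  shows "assignments q (x # xs) ! e = (assignments q xs ! (e mod (q + 1) ^ length xs))
    (x := (None # map Some [1..<Suc q]) ! (e div (q + 1) ^ length xs))"
proof -
  let ?k = "(q + 1) ^ length xs"
  have "assignments q (x # xs) ! e =
      map (\<lambda>f. f(x := (None # map Some [1..<Suc q]) ! (e div ?k))) (assignments q xs) ! (e mod ?k)"
    unfolding assignments.simps using assms
    by (subst nth_concat_map_uniform[where k = ?k]) (simp_all add: length_assignments del: upt_Suc)
  then show ?thesis by (simp add: length_assignments)
qed

lemma symbol_code_nth_assignments:
  assumes "distinct xs" "t < length xs" "e < (q + 1) ^ length xs"
  shows "symbol_code ((assignments q xs ! e) (rev xs ! t)) = e div (q + 1) ^ t mod (q + 1)"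
  using assms
proof (induction xs arbitrary: e)
  case (Cons x xs)
  let ?b = "q + 1" let ?k = "?b ^ length xs"
  have e: "e < ?b ^ Suc (length xs)" using Cons.prems by simp
  show ?case
  proof (cases "t = length xs")
    case True
    have "e div ?k < ?b" using e by (simp add: less_mult_imp_div_less)
    moreover from this have "symbol_code ((None # map Some [1..<Suc q]) ! (e div ?k)) = e div ?k"
      by (cases "e div ?k") (auto simp: nth_append)
    ultimately show ?thesis
      using nth_assignments_Cons[OF e, of x] True by (simp add: nth_append del: upt_Suc)
  next
    case False
    then have t: "t < length xs" using Cons.prems by simp
    then have "rev xs ! t \<in> set xs" using nth_mem[of t "rev xs"] by simp
    then have "rev xs ! t \<noteq> x" using Cons.prems by auto
    moreover have "(e mod ?k) div ?b ^ t mod ?b = e div ?b ^ t mod ?b"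
    proof -
      have k: "?k = ?b ^ t * (?b * ?b ^ (length xs - Suc t))"
        using t by (simp add: Suc_diff_Suc flip: power_Suc power_add)
      show ?thesis unfolding k mod_mult2_eq
        by (simp add: mod_mod_cancel[OF dvd_triv_left] del: mult_Suc)
    qed
    ultimately show ?thesis
      using nth_assignments_Cons[OF e, of x] t Cons by (simp add: nth_append del: upt_Suc)
  qed
qed simp

section \<open>Size of the search tree\<close>

definition branch_base :: "nat \<Rightarrow> nat \<Rightarrow> real" where
  "branch_base q r = ((real q + 1) ^ r - 1) powr (1 / real r)"

lemma branch_base_ge_1:
  assumes "q \<ge> 1" "r \<ge> 1"
  shows "branch_base q r \<ge> 1"
proof -
  have "(real q + 1) ^ 1 \<le> (real q + 1) ^ r" using assms by (intro power_increasing) auto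
  then have "1 \<le> (real q + 1) ^ r - 1" using assms by simp
  then show ?thesis unfolding branch_base_def by (intro ge_one_powr_ge_zero) auto
qed

lemma branch_base_power:
  assumes "q \<ge> 1" "r \<ge> 1"
  shows "branch_base q r ^ k = ((real q + 1) ^ r - 1) powr (real k / real r)"
proof -
  have "branch_base q r > 0" using branch_base_ge_1[OF assms] by simp
  then have "branch_base q r ^ k = branch_base q r powr real k" by (simp add: powr_realpow)
  then show ?thesis by (simp add: branch_base_def powr_powr)
qed

lemma power_minus_one_power_le:
  fixes a :: real
  assumes a: "a \<ge> 1" and ur: "u \<le> r"
  shows "(a ^ u - 1) ^ r \<le> (a ^ r - 1) ^ u"
proof -
  define t where "t k = 1 - (1 / a) ^ k" for k
  have t: "0 \<le> t k" "t k \<le> 1" for k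
    using a one_le_power[OF a, of k] by (simp_all add: t_def power_one_over)
  have split: "a ^ k - 1 = a ^ k * t k" for k
    using a by (simp add: t_def right_diff_distrib power_one_over)
  have "t u \<le> t r" unfolding t_def using a ur by (intro diff_left_mono power_decreasing) auto
  then have "t u ^ r \<le> t r ^ r" using t by (intro power_mono) auto
  also have "\<dots> \<le> t r ^ u" using t ur by (intro power_decreasing) auto
  finally have "(a ^ u) ^ r * t u ^ r \<le> (a ^ u) ^ r * t r ^ u"
    using a by (intro mult_left_mono) auto
  moreover have "(a ^ u) ^ r = (a ^ r) ^ u" by (metis power_mult mult.commute)
  ultimately show ?thesis unfolding split power_mult_distrib by simp
qed

text \<open>Branching on fewer than \<open>r\<close> free variables is at least as good as branching on \<open>r\<close> of them.\<close>

lemma branches_le_base_power: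
  assumes "q \<ge> 1" "1 \<le> u" "u \<le> r"
  shows "(real q + 1) ^ u - 1 \<le> branch_base q r ^ u"
proof -
  have r: "1 \<le> r" using assms by simp
  have "((real q + 1) ^ u - 1) ^ r \<le> ((real q + 1) ^ r - 1) ^ u"
    using assms by (intro power_minus_one_power_le) auto
  also have "(real q + 1) ^ r - 1 = branch_base q r ^ r"
    using branch_base_power[OF assms(1) r, of r] one_le_power[of "real q + 1" r] r assms(1) by simp
  also have "(branch_base q r ^ r) ^ u = (branch_base q r ^ u) ^ r"
    by (metis power_mult mult.commute)
  finally show ?thesis
    by (subst (asm) power_mono_iff) (use r branch_base_ge_1[OF assms(1) r] assms(1) in auto)
qed

section \<open>Branching on a constraint\<close>

lemma total_cost_wildcard_le:
  assumes inst: "wcsp_instance q r I" and C: "C \<in># Constraints I" and v: "v \<in> C"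
    and \<phi>: "\<phi> \<in> wfuns q (Vars I)"
    and less: "Cost I C ((restrict \<phi> C)(v := None)) < Cost I C (restrict \<phi> C)"
  shows "total_cost I (\<phi>(v := None)) \<le> total_cost I \<phi>"
proof -
  let ?\<psi> = "\<phi>(v := None)"
  obtain M where M: "Constraints I = add_mset C M" using C by (metis multi_member_split)
  have sub: "D \<subseteq> Vars I" if "D \<in># Constraints I" for D
    using inst that by (simp add: wcsp_instance_def)
  have \<psi>: "?\<psi> \<in> wfuns q (Vars I)" using wfuns_upd_wildcard[OF \<phi>] v sub[OF C] by auto
  have mono: "Cost I D (restrict ?\<psi> D) \<le> Cost I D (restrict \<phi> D)" if "D \<in># M" for D
  proof -
    have D: "D \<in># Constraints I" using that by (simp add: M)
    have "wle D (restrict \<phi> D) (restrict ?\<psi> D)" by (simp add: wle_def)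
    then show ?thesis
      using inst D restrict_wfuns[OF \<phi> sub[OF D]] restrict_wfuns[OF \<psi> sub[OF D]]
      unfolding wcsp_instance_def by blast
  qed
  have "wnorm (Vars I) ?\<psi> \<le> card (insert v {x \<in> Vars I. \<phi> x = None})"
    unfolding wnorm_def using inst by (intro card_mono) (auto simp: wcsp_instance_def)
  also have "\<dots> \<le> Suc (wnorm (Vars I) \<phi>)"
    using inst by (simp add: wnorm_def wcsp_instance_def card_insert_if)
  finally have "wnorm (Vars I) ?\<psi> \<le> Suc (wnorm (Vars I) \<phi>)" .
  moreover have "restrict ?\<psi> C = (restrict \<phi> C)(v := None)" using v by auto
  moreover have "(\<Sum>D\<in>#M. Cost I D (restrict ?\<psi> D)) \<le> (\<Sum>D\<in>#M. Cost I D (restrict \<phi> D))"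
    using mono by (rule sum_mset_mono)
  ultimately show ?thesis using less by (simp add: total_cost_def M)
qed

locale wcsp_enumeration =
  fixes q r :: nat and I :: wcsp and vs :: "nat list" and cs :: "nat set list"
  assumes q_pos: "q \<ge> 1" and r_pos: "r \<ge> 1" and inst: "wcsp_instance q r I"
    and distinct_vs: "distinct vs" and set_vs: "set vs = Vars I"
    and distinct_cs: "distinct cs" and set_cs: "set cs = set_mset (Constraints I)"
begin

lemma finite_Vars [simp]: "finite (Vars I)"
  using inst by (simp add: wcsp_instance_def)

lemma constraint_subset: "C \<in># Constraints I \<Longrightarrow> C \<subseteq> Vars I"
  using inst by (simp add: wcsp_instance_def)

lemma constraint_card: "C \<in># Constraints I \<Longrightarrow> card C \<le> r"
  using inst by (simp add: wcsp_instance_def)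

lemma constraint_finite: "C \<in># Constraints I \<Longrightarrow> finite C"
  using constraint_subset finite_subset finite_Vars by blast

lemma length_vs: "length vs = card (Vars I)"
  using distinct_card[OF distinct_vs] by (simp add: set_vs)

definition scope :: "nat set \<Rightarrow> nat list" where
  "scope C = filter (\<lambda>v. v \<in> C) vs"

lemma distinct_scope [simp]: "distinct (scope C)"
  using distinct_vs by (simp add: scope_def)

lemma set_scope: "C \<in># Constraints I \<Longrightarrow> set (scope C) = C"
  using constraint_subset[of C] by (auto simp: scope_def set_vs)

lemma length_scope_le: "C \<in># Constraints I \<Longrightarrow> length (scope C) \<le> r"
  using distinct_card[OF distinct_scope, of C] constraint_card[of C] by (simp add: set_scope)

text \<open>In a node of the search tree the variables outside of the domain are free, whereas
  \<^term>\<open>Some None\<close> is a decision for the wildcard.\<close>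

type_synonym node = "nat \<Rightarrow> nat option option"

definition nodes :: "node set" where
  "nodes = {\<sigma>. dom \<sigma> \<subseteq> Vars I \<and> ran \<sigma> \<subseteq> wvalues q}"

definition free_vars :: "node \<Rightarrow> nat set" where
  "free_vars \<sigma> = Vars I - dom \<sigma>"

definition compatible :: "node \<Rightarrow> nat set \<Rightarrow> (nat \<Rightarrow> nat option) \<Rightarrow> bool" where
  "compatible \<sigma> X f \<longleftrightarrow> (\<forall>v\<in>X. \<sigma> v = None \<or> \<sigma> v = Some (f v))"

definition entries :: "node \<Rightarrow> nat set \<Rightarrow> (nat \<Rightarrow> nat option) list" where
  "entries \<sigma> C = filter (compatible \<sigma> C) (assignments q (scope C))"

definition refine :: "node \<Rightarrow> nat set \<Rightarrow> (nat \<Rightarrow> nat option) \<Rightarrow> node" where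
  "refine \<sigma> C f = override_on \<sigma> (\<lambda>v. Some (f v)) C"

definition children :: "node \<Rightarrow> nat set \<Rightarrow> node list" where
  "children \<sigma> C = map (refine \<sigma> C) (drop_deviation (Cost I C) (entries \<sigma> C))"

abbreviation deviation :: "node \<Rightarrow> nat set \<Rightarrow> (nat \<Rightarrow> nat option) option" where
  "deviation \<sigma> C \<equiv> first_deviation (Cost I C) (entries \<sigma> C)"

definition branching_constraint :: "node \<Rightarrow> nat set list \<Rightarrow> nat set option" where
  "branching_constraint \<sigma> Cs = List.find (\<lambda>C. deviation \<sigma> C \<noteq> None) Cs"

lemma compatible_restrict [simp]: "compatible \<sigma> X (restrict f X) \<longleftrightarrow> compatible \<sigma> X f"
  by (simp add: compatible_def)

lemma compatible_subset: "compatible \<sigma> X f \<Longrightarrow> Y \<subseteq> X \<Longrightarrow> compatible \<sigma> Y f"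
  by (auto simp: compatible_def)

lemma compatible_upd: "compatible \<sigma> X f \<Longrightarrow> \<sigma> v = None \<Longrightarrow> compatible \<sigma> X (f(v := a))"
  by (auto simp: compatible_def)

lemma finite_free_vars [simp]: "finite (free_vars \<sigma>)"
  by (simp add: free_vars_def)

lemma nodes_value: "\<sigma> \<in> nodes \<Longrightarrow> \<sigma> v = Some a \<Longrightarrow> a \<in> wvalues q"
  by (auto simp: nodes_def ran_def)

lemma free_vars_refine: "free_vars (refine \<sigma> C f) = free_vars \<sigma> - C"
  by (auto simp: free_vars_def refine_def override_on_def split: if_splits)

lemma refine_in_nodes:
  assumes "\<sigma> \<in> nodes" "C \<in># Constraints I" "f \<in> wfuns q C"
  shows "refine \<sigma> C f \<in> nodes"
  using assms constraint_subset[of C]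
  by (auto simp: nodes_def refine_def override_on_def wfuns_def dom_def ran_def split: if_splits)

lemma compatible_refine:
  "compatible \<sigma> (Vars I) \<phi> \<Longrightarrow> compatible (refine \<sigma> C (restrict \<phi> C)) (Vars I) \<phi>"
  by (auto simp: compatible_def refine_def override_on_def)

lemma set_entries:
  "C \<in># Constraints I \<Longrightarrow> set (entries \<sigma> C) = {f \<in> wfuns q C. compatible \<sigma> C f}"
  by (auto simp: entries_def set_assignments set_scope)

lemma distinct_entries [simp]: "distinct (entries \<sigma> C)"
  by (simp add: entries_def distinct_assignments)

lemma restrict_in_entries:
  assumes "C \<in># Constraints I" "\<phi> \<in> wfuns q (Vars I)" "compatible \<sigma> (Vars I) \<phi>"
  shows "restrict \<phi> C \<in> set (entries \<sigma> C)"
  using assms restrict_wfuns[of \<phi> q "Vars I" C] constraint_subset[of C]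
    compatible_subset[of \<sigma> "Vars I" \<phi> C]
  by (simp add: set_entries)

lemma length_entries:
  assumes C: "C \<in># Constraints I" and \<sigma>: "\<sigma> \<in> nodes"
  shows "length (entries \<sigma> C) = (q + 1) ^ card (free_vars \<sigma> \<inter> C)"
proof -
  define S where "S v = (case \<sigma> v of None \<Rightarrow> wvalues q | Some a \<Rightarrow> {a})" for v
  have "a \<in> S v \<longleftrightarrow> a \<in> wvalues q \<and> (\<sigma> v = None \<or> \<sigma> v = Some a)" for v a
    using nodes_value[OF \<sigma>] by (auto simp: S_def split: option.split)
  then have "set (entries \<sigma> C) = Pi\<^sub>E C S"
    by (auto simp: set_entries[OF C] wfuns_def compatible_def PiE_def Pi_def)
  then have "length (entries \<sigma> C) = card (Pi\<^sub>E C S)"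
    using distinct_card[OF distinct_entries, of \<sigma> C] by simp
  also have "\<dots> = (\<Prod>v\<in>C. card (S v))" by (rule card_PiE[OF constraint_finite[OF C]])
  also have "\<dots> = (\<Prod>v\<in>C. if v \<in> free_vars \<sigma> then q + 1 else 1)"
    using constraint_subset[OF C]
    by (intro prod.cong) (auto simp: S_def free_vars_def card_wvalues split: option.split)
  also have "\<dots> = (q + 1) ^ card (free_vars \<sigma> \<inter> C)"
    using constraint_finite[OF C] by (simp add: prod.If_cases Int_commute)
  finally show ?thesis .
qed

text \<open>On some free variable the value of \<open>f\<close> exceeds that of the first entry. Replacing it by the
  wildcard gives an entry before \<open>f\<close>, which has the common cost of all entries before \<open>f\<close>.\<close>

lemma first_deviation_improvable:
  assumes C: "C \<in># Constraints I" and dev: "deviation \<sigma> C = Some f"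
  obtains v where "v \<in> C" "\<sigma> v = None" "Cost I C (f(v := None)) < Cost I C f"
proof -
  let ?c = "Cost I C" let ?es = "entries \<sigma> C"
  obtain before after where es: "?es = before @ f # after" and f: "?c f \<noteq> ?c (hd ?es)"
    and common: "\<forall>g\<in>set before. ?c g = ?c (hd ?es)"
    using dev unfolding first_deviation_def by (auto elim!: find_SomeE)
  have sorted: "sorted_wrt (\<lambda>g h. \<exists>v\<in>C. symbol_code (g v) < symbol_code (h v)) ?es"
    unfolding entries_def
    using sorted_wrt_assignments[OF distinct_scope, of C q] set_scope[OF C]
    by (simp add: sorted_wrt_filter)
  have "before \<noteq> []" using es f by auto
  then have hd: "hd ?es \<in> set before" by (simp add: es)
  then obtain v where v: "v \<in> C" "symbol_code (hd ?es v) < symbol_code (f v)"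
    using sorted unfolding es by (auto simp: sorted_wrt_append)
  have wf: "f \<in> wfuns q C" "compatible \<sigma> C f" "compatible \<sigma> C (hd ?es)"
    using set_entries[OF C, of \<sigma>] hd unfolding es by auto
  then have "\<sigma> v = None \<or> f v = hd ?es v"
    using v(1) unfolding compatible_def by (metis option.inject)
  then have free: "\<sigma> v = None" using v(2) by auto
  let ?g = "f(v := None)"
  have "?g \<in> set ?es"
    using wf free v wfuns_upd_wildcard by (simp add: set_entries[OF C] compatible_upd)
  moreover have "?g \<noteq> f" using v(2) by (metis fun_upd_same less_nat_zero_code symbol_code_simps(1))
  moreover have "?g \<notin> set after"
    using sorted unfolding es by (auto simp: sorted_wrt_append split: if_splits)
  ultimately have "?g \<in> set before" unfolding es by auto
  then have "?c ?g \<noteq> ?c f" using common f by auto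
  moreover have "wle C f ?g" by (simp add: wle_def)
  then have "?c ?g \<le> ?c f"
    using inst C wf(1) wfuns_upd_wildcard[OF wf(1) v(1)] unfolding wcsp_instance_def by blast
  ultimately show thesis using that[OF v(1) free] by simp
qed

definition admits :: "node \<Rightarrow> nat \<Rightarrow> bool" where
  "admits \<sigma> k \<longleftrightarrow> (\<exists>\<phi>\<in>wfuns q (Vars I). compatible \<sigma> (Vars I) \<phi> \<and> total_cost I \<phi> \<le> k)"

lemma child_admits:
  assumes C: "C \<in># Constraints I" and dev: "deviation \<sigma> C = Some f"
    and \<phi>: "\<phi> \<in> wfuns q (Vars I)" "compatible \<sigma> (Vars I) \<phi>" "total_cost I \<phi> \<le> k"
    and neq: "restrict \<phi> C \<noteq> f"
  shows "\<exists>\<tau>\<in>set (children \<sigma> C). admits \<tau> k"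
proof
  have "restrict \<phi> C \<in> set (drop_deviation (Cost I C) (entries \<sigma> C))"
    using restrict_in_entries[OF C \<phi>(1,2)] neq dev by (simp add: drop_deviation_def)
  then show "refine \<sigma> C (restrict \<phi> C) \<in> set (children \<sigma> C)" by (simp add: children_def)
  show "admits (refine \<sigma> C (restrict \<phi> C)) k"
    using \<phi> compatible_refine unfolding admits_def by blast
qed

lemma admits_children:
  assumes C: "C \<in># Constraints I" and dev: "deviation \<sigma> C \<noteq> None"
    and adm: "admits \<sigma> k"
  shows "\<exists>\<tau>\<in>set (children \<sigma> C). admits \<tau> k"
proof -
  obtain f where f: "deviation \<sigma> C = Some f" using dev by blast
  obtain \<phi> where \<phi>: "\<phi> \<in> wfuns q (Vars I)" "compatible \<sigma> (Vars I) \<phi>" "total_cost I \<phi> \<le> k"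
    using adm by (auto simp: admits_def)
  obtain v where v: "v \<in> C" "\<sigma> v = None" "Cost I C (f(v := None)) < Cost I C f"
    using first_deviation_improvable[OF C f] .
  show ?thesis
  proof (cases "restrict \<phi> C = f")
    case True
    have "restrict (\<phi>(v := None)) C = f(v := None)" using True v(1) by auto
    moreover have "f(v := None) \<noteq> f" using v(3) by (metis less_irrefl)
    ultimately have "restrict (\<phi>(v := None)) C \<noteq> f" by simp
    moreover have "total_cost I (\<phi>(v := None)) \<le> k"
      using total_cost_wildcard_le[OF inst C v(1) \<phi>(1)] True v(3) \<phi>(3) by simp
    ultimately show ?thesis
      using v \<phi> constraint_subset[OF C]
      by (intro child_admits[OF C f]) (auto intro: wfuns_upd_wildcard compatible_upd)
  qed (use child_admits[OF C f] \<phi> in blast)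
qed

lemma children_in_nodes:
  assumes "\<sigma> \<in> nodes" "C \<in># Constraints I"
  shows "set (children \<sigma> C) \<subseteq> nodes"
  using set_drop_deviation_subset[of "Cost I C" "entries \<sigma> C"] refine_in_nodes[OF assms]
    set_entries[OF assms(2)]
  by (fastforce simp: children_def)

lemma free_vars_children: "\<tau> \<in> set (children \<sigma> C) \<Longrightarrow> free_vars \<tau> = free_vars \<sigma> - C"
  by (auto simp: children_def free_vars_refine)

lemma length_children:
  assumes C: "C \<in># Constraints I" and \<sigma>: "\<sigma> \<in> nodes"
    and dev: "deviation \<sigma> C \<noteq> None"
  shows "length (children \<sigma> C) < (q + 1) ^ card (free_vars \<sigma> \<inter> C)"
proof -
  obtain f where f: "deviation \<sigma> C = Some f" using dev by blast
  then have "f \<in> set (entries \<sigma> C)" by (rule first_deviation_in_set)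
  then have "length (children \<sigma> C) < length (entries \<sigma> C)"
    using f length_pos_if_in_set[of f "entries \<sigma> C"]
    by (simp add: children_def drop_deviation_def length_remove1)
  then show ?thesis by (simp add: length_entries[OF C \<sigma>])
qed

text \<open>Free variables are set to a value rather than to the wildcard, which costs 1.\<close>

definition completion :: "node \<Rightarrow> nat \<Rightarrow> nat option" where
  "completion \<sigma> = (\<lambda>v\<in>Vars I. case \<sigma> v of None \<Rightarrow> Some 1 | Some a \<Rightarrow> a)"

lemma completion_wfuns: "\<sigma> \<in> nodes \<Longrightarrow> completion \<sigma> \<in> wfuns q (Vars I)"
  using q_pos nodes_value[of \<sigma>]
  by (auto simp: completion_def wfuns_def wvalues_def split: option.split)

lemma compatible_completion: "compatible \<sigma> (Vars I) (completion \<sigma>)"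
  by (auto simp: compatible_def completion_def split: option.split)

definition base_cost :: "node \<Rightarrow> nat set \<Rightarrow> nat" where
  "base_cost \<sigma> C = Cost I C (hd (entries \<sigma> C))"

lemma Cost_eq_base_cost:
  assumes "C \<in># Constraints I" "deviation \<sigma> C = None"
    and "\<phi> \<in> wfuns q (Vars I)" "compatible \<sigma> (Vars I) \<phi>"
  shows "Cost I C (restrict \<phi> C) = base_cost \<sigma> C"
  using first_deviation_NoneD[OF assms(2) restrict_in_entries[OF assms(1,3,4)]]
  by (simp add: base_cost_def)

lemma total_cost_sum_list:
  "total_cost I \<phi> =
     wnorm (Vars I) \<phi> + (\<Sum>C\<leftarrow>cs. count (Constraints I) C * Cost I C (restrict \<phi> C))"
  by (simp add: total_cost_def sum_mset_count sum_list_distinct_conv_sum_set[OF distinct_cs] set_cs)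

lemma total_cost_leaf:
  assumes "branching_constraint \<sigma> cs = None"
    and "\<phi> \<in> wfuns q (Vars I)" "compatible \<sigma> (Vars I) \<phi>"
  shows "total_cost I \<phi> =
    wnorm (Vars I) \<phi> + (\<Sum>C\<leftarrow>cs. count (Constraints I) C * base_cost \<sigma> C)"
proof -
  have "Cost I C (restrict \<phi> C) = base_cost \<sigma> C" if "C \<in> set cs" for C
    using that assms set_cs
    by (intro Cost_eq_base_cost) (auto simp: branching_constraint_def find_None_iff)
  then show ?thesis unfolding total_cost_sum_list by (simp cong: map_cong)
qed

lemma wnorm_completion: "wnorm (Vars I) (completion \<sigma>) = card {v \<in> Vars I. \<sigma> v = Some None}"
  unfolding wnorm_def completion_def by (rule arg_cong[of _ _ card]) (auto split: option.splits)

lemma wnorm_completion_le: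
  assumes "compatible \<sigma> (Vars I) \<phi>"
  shows "wnorm (Vars I) (completion \<sigma>) \<le> wnorm (Vars I) \<phi>"
  unfolding wnorm_completion unfolding wnorm_def
  using assms by (intro card_mono) (auto simp: compatible_def)

lemma total_cost_completion_le:
  assumes "\<sigma> \<in> nodes" "branching_constraint \<sigma> cs = None" "admits \<sigma> k"
  shows "total_cost I (completion \<sigma>) \<le> k"
proof -
  obtain \<phi> where \<phi>: "\<phi> \<in> wfuns q (Vars I)" "compatible \<sigma> (Vars I) \<phi>" "total_cost I \<phi> \<le> k"
    using assms(3) by (auto simp: admits_def)
  show ?thesis
    using \<phi>(3) total_cost_leaf[OF assms(2) \<phi>(1,2)] wnorm_completion_le[OF \<phi>(2)]
      total_cost_leaf[OF assms(2) completion_wfuns[OF assms(1)] compatible_completion]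
    by simp
qed

section \<open>Depth-first search\<close>

definition improve :: "node option \<Rightarrow> node \<Rightarrow> node option" where
  "improve best \<sigma> = (case best of None \<Rightarrow> Some \<sigma>
     | Some \<beta> \<Rightarrow> if total_cost I (completion \<sigma>) < total_cost I (completion \<beta>) then Some \<sigma> else best)"

fun search_step :: "node \<Rightarrow> node list \<times> node option \<Rightarrow> node list \<times> node option" where
  "search_step \<sigma> (stack, best) = (case branching_constraint \<sigma> cs of
     Some C \<Rightarrow> (stack @ children \<sigma> C, best)
   | None \<Rightarrow> (stack, improve best \<sigma>))"

fun search_inv :: "node list \<times> node option \<Rightarrow> bool" where
  "search_inv (stack, best) \<longleftrightarrow> set stack \<subseteq> nodes \<and> set_option best \<subseteq> nodes \<and>
     (\<forall>k. admits Map.empty k \<longrightarrow>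
        (\<exists>\<sigma>\<in>set stack. admits \<sigma> k) \<or> (\<exists>\<beta>. best = Some \<beta> \<and> total_cost I (completion \<beta>) \<le> k))"

lemma search_inv_init: "search_inv ([Map.empty], None)"
  by (auto simp: nodes_def)

lemma branching_constraint_SomeD:
  assumes "branching_constraint \<sigma> cs = Some C"
  shows "C \<in># Constraints I" "deviation \<sigma> C \<noteq> None"
proof -
  have "C \<in> set cs" using assms by (auto simp: branching_constraint_def find_Some_iff)
  then show "C \<in># Constraints I" by (simp add: set_cs)
  show "deviation \<sigma> C \<noteq> None"
    using assms by (auto simp: branching_constraint_def find_Some_iff)
qed

lemma search_inv_step:
  assumes inv: "search_inv (stack @ [\<sigma>], best)"
  shows "search_inv (search_step \<sigma> (stack, best))"
proof (cases "branching_constraint \<sigma> cs")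
  case None
  have "total_cost I (completion \<sigma>) \<le> k" if "admits \<sigma> k" for k
    using total_cost_completion_le[OF _ None that] inv by simp
  then show ?thesis
    using inv None by (fastforce simp: improve_def split: option.split)
next
  case (Some C)
  note C = branching_constraint_SomeD[OF Some]
  show ?thesis
    using inv Some children_in_nodes[OF _ C(1)] admits_children[OF C] by fastforce
qed

lemma search_inv_final:
  assumes "search_inv ([], best)"
  obtains \<beta> where "best = Some \<beta>" "\<beta> \<in> nodes" "optimal q I (completion \<beta>)"
proof -
  have attained: "\<exists>\<beta>. best = Some \<beta> \<and> total_cost I (completion \<beta>) \<le> total_cost I \<psi>"
    if "\<psi> \<in> wfuns q (Vars I)" for \<psi>
    using assms that by (fastforce simp: admits_def compatible_def)
  have "(\<lambda>v\<in>Vars I. None) \<in> wfuns q (Vars I)" by (simp add: wfuns_def wvalues_def)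
  with attained obtain \<beta> where \<beta>: "best = Some \<beta>" by blast
  then have "\<beta> \<in> nodes" using assms by simp
  then show thesis
    using that[OF \<beta>] attained \<beta> completion_wfuns by (fastforce simp: optimal_def)
qed

text \<open>A stack position is at most \<open>(q + 1)\<^sup>r\<close> times the number of variables fixed there, which keeps
  the memory polynomial.\<close>

definition height_bounded :: "node list \<Rightarrow> bool" where
  "height_bounded stack \<longleftrightarrow>
     (\<forall>i<length stack. i + card (free_vars (stack ! i)) * (q + 1) ^ r \<le> length vs * (q + 1) ^ r)"

lemma card_free_vars_le: "card (free_vars \<sigma>) \<le> length vs"
  unfolding length_vs free_vars_def by (intro card_mono) auto

lemma height_bounded_singleton: "height_bounded [\<sigma>]"
  using card_free_vars_le by (simp add: height_bounded_def)

lemma height_boundedD: "height_bounded (stack @ [\<sigma>]) \<Longrightarrow> length stack \<le> length vs * (q + 1) ^ r"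
  by (auto simp: height_bounded_def dest!: spec[of _ "length stack"])

lemma children_sizes:
  assumes \<sigma>: "\<sigma> \<in> nodes" and branch: "branching_constraint \<sigma> cs = Some C"
  defines "u \<equiv> card (free_vars \<sigma> \<inter> C)"
  shows "1 \<le> u" "u \<le> r" "u \<le> card (free_vars \<sigma>)" "length (children \<sigma> C) < (q + 1) ^ u"
    and "\<And>\<tau>. \<tau> \<in> set (children \<sigma> C) \<Longrightarrow> card (free_vars \<tau>) = card (free_vars \<sigma>) - u"
proof -
  note C = branching_constraint_SomeD[OF branch]
  obtain f where "deviation \<sigma> C = Some f" using C(2) by blast
  from first_deviation_improvable[OF C(1) this] obtain v where "v \<in> C" "\<sigma> v = None" .
  then have "v \<in> free_vars \<sigma> \<inter> C" using constraint_subset[OF C(1)] by (auto simp: free_vars_def)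
  then show "1 \<le> u" by (auto simp: u_def Suc_le_eq card_gt_0_iff)
  show "u \<le> r"
    using card_mono[OF constraint_finite[OF C(1)], of "free_vars \<sigma> \<inter> C"] constraint_card[OF C(1)]
    by (simp add: u_def)
  show "u \<le> card (free_vars \<sigma>)" unfolding u_def by (intro card_mono) auto
  show "length (children \<sigma> C) < (q + 1) ^ u"
    unfolding u_def by (rule length_children[OF C(1) \<sigma> C(2)])
  show "card (free_vars \<tau>) = card (free_vars \<sigma>) - u" if "\<tau> \<in> set (children \<sigma> C)" for \<tau>
    using free_vars_children[OF that] by (simp add: u_def card_Diff_subset_Int)
qed

lemma length_children_less:
  assumes "\<sigma> \<in> nodes" "branching_constraint \<sigma> cs = Some C"
  shows "length (children \<sigma> C) < (q + 1) ^ r"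
  using less_le_trans[OF children_sizes(4)[OF assms] power_increasing] children_sizes(2)[OF assms]
  by simp

lemma height_bounded_step:
  assumes \<sigma>: "\<sigma> \<in> nodes" and stack: "height_bounded (stack @ [\<sigma>])"
  shows "height_bounded (fst (search_step \<sigma> (stack, best)))"
proof (cases "branching_constraint \<sigma> cs")
  case None
  then show ?thesis
    using stack by (auto simp: height_bounded_def nth_append dest: less_SucI split: if_splits)
next
  case (Some C)
  let ?D = "(q + 1) ^ r"
  have "i + card (free_vars ((stack @ children \<sigma> C) ! i)) * ?D \<le> length vs * ?D"
    if i: "i < length (stack @ children \<sigma> C)" for i
  proof (cases "i < length stack")
    case True
    then show ?thesis using stack by (auto simp: height_bounded_def nth_append dest!: spec[of _ i])
  next
    case False
    then have "(stack @ children \<sigma> C) ! i \<in> set (children \<sigma> C)" using i by (simp add: nth_append)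
    then have "Suc (card (free_vars ((stack @ children \<sigma> C) ! i))) \<le> card (free_vars \<sigma>)"
      using children_sizes(1,3,5)[OF \<sigma> Some] by auto
    from mult_le_mono1[OF this, of ?D]
    have "?D + card (free_vars ((stack @ children \<sigma> C) ! i)) * ?D \<le> card (free_vars \<sigma>) * ?D" by simp
    moreover have "length stack + card (free_vars \<sigma>) * ?D \<le> length vs * ?D"
      using stack by (auto simp: height_bounded_def dest!: spec[of _ "length stack"])
    ultimately show ?thesis using i length_children_less[OF \<sigma> Some] by simp
  qed
  then show ?thesis using Some by (simp add: height_bounded_def)
qed

text \<open>The factor beyond the power of the branching base accounts for the inner nodes of the search tree.\<close>

definition weight :: "node \<Rightarrow> real" where
  "weight \<sigma> = branch_base q r ^ card (free_vars \<sigma>) * (real (card (free_vars \<sigma>)) + 1)"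

definition potential :: "node list \<Rightarrow> real" where
  "potential stack = (\<Sum>\<sigma>\<leftarrow>stack. weight \<sigma>)"

lemma weight_ge_1: "weight \<sigma> \<ge> 1"
proof -
  have "1 * 1 \<le> branch_base q r ^ card (free_vars \<sigma>) * (real (card (free_vars \<sigma>)) + 1)"
    using branch_base_ge_1[OF q_pos r_pos] by (intro mult_mono one_le_power) auto
  then show ?thesis by (simp add: weight_def)
qed

lemma weight_le: "weight \<sigma> \<le> branch_base q r ^ length vs * (real (length vs) + 1)"
  unfolding weight_def using card_free_vars_le[of \<sigma>] branch_base_ge_1[OF q_pos r_pos]
  by (intro mult_mono power_increasing) auto

lemma potential_nonneg: "potential stack \<ge> 0"
  unfolding potential_def by (intro sum_list_nonneg) (auto intro: order_trans[OF _ weight_ge_1])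

lemma potential_children:
  assumes \<sigma>: "\<sigma> \<in> nodes" and branch: "branching_constraint \<sigma> cs = Some C"
  shows "potential (children \<sigma> C) + 1 \<le> weight \<sigma>"
proof -
  let ?b = "branch_base q r" let ?f = "card (free_vars \<sigma>)"
  define u where "u = card (free_vars \<sigma> \<inter> C)"
  note u = children_sizes[OF \<sigma> branch, folded u_def]
  have b: "?b \<ge> 1" using branch_base_ge_1[OF q_pos r_pos] .
  have "potential (children \<sigma> C) = (\<Sum>\<tau>\<leftarrow>children \<sigma> C. ?b ^ (?f - u) * (real (?f - u) + 1))"
    unfolding potential_def weight_def
    by (intro arg_cong[of _ _ sum_list] map_cong) (simp_all add: u(5))
  also have "\<dots> = real (length (children \<sigma> C)) * (?b ^ (?f - u) * (real (?f - u) + 1))"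
    by (simp add: sum_list_triv)
  also have "\<dots> \<le> ?b ^ u * (?b ^ (?f - u) * (real (?f - u) + 1))"
  proof (intro mult_right_mono)
    have "real (length (children \<sigma> C)) + 1 \<le> real ((q + 1) ^ u)" using u(4) by linarith
    then show "real (length (children \<sigma> C)) \<le> ?b ^ u"
      using branches_le_base_power[OF q_pos u(1,2)] by (simp add: add.commute)
  qed (use b in auto)
  also have "\<dots> = ?b ^ ?f * (real ?f - real u + 1)"
    using u(3) by (simp add: of_nat_diff flip: power_add)
  finally have "potential (children \<sigma> C) \<le> ?b ^ ?f * (real ?f - real u + 1)" .
  moreover have "1 * 1 \<le> ?b ^ ?f * real u" using b u(1) by (intro mult_mono one_le_power) auto
  ultimately show ?thesis unfolding weight_def by (simp add: algebra_simps)
qed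

lemma potential_step:
  assumes "\<sigma> \<in> nodes"
  shows "potential (fst (search_step \<sigma> (stack, best))) + 1 \<le> potential (stack @ [\<sigma>])"
  using potential_children[OF assms] weight_ge_1[of \<sigma>]
  by (auto simp: potential_def split: option.split)

end

section \<open>Weakest preconditions for word RAM programs\<close>

fun val :: "ram \<Rightarrow> expr \<Rightarrow> nat" where
  "val s (Num k) = k"
| "val s (Reg x) = regs s x"
| "val s (Mem e) = mem s (val s e)"
| "val s (Op f e1 e2) = arith_fun f (val s e1) (val s e2)"

fun fits :: "nat \<Rightarrow> ram \<Rightarrow> expr \<Rightarrow> bool" where
  "fits W s (Num k) \<longleftrightarrow> k < W"
| "fits W s (Reg x) \<longleftrightarrow> regs s x < W"
| "fits W s (Mem e) \<longleftrightarrow> fits W s e \<and> mem s (val s e) < W"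
| "fits W s (Op f e1 e2) \<longleftrightarrow> fits W s e1 \<and> fits W s e2 \<and> arith_fun f (val s e1) (val s e2) < W"

lemma eval_val: "fits W s e \<Longrightarrow> eval W s e = Some (val s e)"
  by (induction e) (auto simp: word_def)

text \<open>\<open>wp W \<kappa> p Q s\<close>: started in \<open>s\<close>, the program \<open>p\<close> halts in a state satisfying \<open>Q\<close>, and every
  execution of a loop with guard \<open>e\<close> takes at most \<open>\<kappa> e\<close> iterations.\<close>

primrec unroll :: "nat \<Rightarrow> expr \<Rightarrow> ((ram \<Rightarrow> bool) \<Rightarrow> ram \<Rightarrow> bool) \<Rightarrow> (ram \<Rightarrow> bool) \<Rightarrow>
    nat \<Rightarrow> ram \<Rightarrow> bool" where
  "unroll W e body Q 0 = (\<lambda>s. fits W s e \<and> val s e = 0 \<and> Q s)"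
| "unroll W e body Q (Suc k) =
     (\<lambda>s. fits W s e \<and> (if val s e \<noteq> 0 then body (unroll W e body Q k) s else Q s))"

primrec wp :: "nat \<Rightarrow> (expr \<Rightarrow> nat) \<Rightarrow> prog \<Rightarrow> (ram \<Rightarrow> bool) \<Rightarrow> ram \<Rightarrow> bool" where
  "wp W \<kappa> Skip = (\<lambda>Q. Q)"
| "wp W \<kappa> (Assign x e) = (\<lambda>Q s. fits W s e \<and> Q (s\<lparr>regs := (regs s)(x := val s e)\<rparr>))"
| "wp W \<kappa> (Store e1 e2) =
     (\<lambda>Q s. fits W s e1 \<and> fits W s e2 \<and> Q (s\<lparr>mem := (mem s)(val s e1 := val s e2)\<rparr>))"
| "wp W \<kappa> (Seq p1 p2) = (\<lambda>Q. wp W \<kappa> p1 (wp W \<kappa> p2 Q))"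
| "wp W \<kappa> (Cond e p1 p2) =
     (\<lambda>Q s. fits W s e \<and> (if val s e \<noteq> 0 then wp W \<kappa> p1 Q s else wp W \<kappa> p2 Q s))"
| "wp W \<kappa> (While e p) = (\<lambda>Q. unroll W e (wp W \<kappa> p) Q (\<kappa> e))"

primrec time_bound :: "(expr \<Rightarrow> nat) \<Rightarrow> prog \<Rightarrow> nat" where
  "time_bound \<kappa> Skip = 1"
| "time_bound \<kappa> (Assign x e) = 1 + etime e"
| "time_bound \<kappa> (Store e1 e2) = 1 + etime e1 + etime e2"
| "time_bound \<kappa> (Seq p1 p2) = 1 + time_bound \<kappa> p1 + time_bound \<kappa> p2"
| "time_bound \<kappa> (Cond e p1 p2) = 1 + etime e + max (time_bound \<kappa> p1) (time_bound \<kappa> p2)"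
| "time_bound \<kappa> (While e p) = 1 + etime e + \<kappa> e * (1 + etime e + time_bound \<kappa> p)"

primrec guards :: "prog \<Rightarrow> expr set" where
  "guards Skip = {}"
| "guards (Assign x e) = {}"
| "guards (Store e1 e2) = {}"
| "guards (Seq p1 p2) = guards p1 \<union> guards p2"
| "guards (Cond e p1 p2) = guards p1 \<union> guards p2"
| "guards (While e p) = insert e (guards p)"

primrec loop_depth :: "prog \<Rightarrow> nat" where
  "loop_depth Skip = 0"
| "loop_depth (Assign x e) = 0"
| "loop_depth (Store e1 e2) = 0"
| "loop_depth (Seq p1 p2) = max (loop_depth p1) (loop_depth p2)"
| "loop_depth (Cond e p1 p2) = max (loop_depth p1) (loop_depth p2)"
| "loop_depth (While e p) = Suc (loop_depth p)"

lemma wp_mono: "wp W \<kappa> p Q s \<Longrightarrow> (\<And>s. Q s \<Longrightarrow> Q' s) \<Longrightarrow> wp W \<kappa> p Q' s"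
proof (induction p arbitrary: Q Q' s)
  case (Seq p1 p2)
  show ?case
    using Seq.prems(1) Seq.IH(1)[of "wp W \<kappa> p2 Q" s "wp W \<kappa> p2 Q'"] Seq.IH(2)[OF _ Seq.prems(2)]
    by simp
next
  case (Cond e p1 p2)
  then show ?case by (auto split: if_splits)
next
  case (While e p)
  have "unroll W e (wp W \<kappa> p) Q k s \<Longrightarrow> unroll W e (wp W \<kappa> p) Q' k s" for k s
  proof (induction k arbitrary: s)
    case (Suc k)
    then show ?case
      using While.IH[of "unroll W e (wp W \<kappa> p) Q k" s "unroll W e (wp W \<kappa> p) Q' k"] While.prems(2)
      by (auto split: if_splits)
  qed (use While.prems(2) in simp)
  then show ?case using While.prems(1) by simp
qed auto

lemma wp_SeqI:
  "wp W \<kappa> p1 Q s \<Longrightarrow> (\<And>s. Q s \<Longrightarrow> wp W \<kappa> p2 R s) \<Longrightarrow> wp W \<kappa> (Seq p1 p2) R s"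
  using wp_mono[of W \<kappa> p1 Q s "wp W \<kappa> p2 R"] by simp

lemma exec_While_unroll:
  assumes body: "\<And>Q s. wp W \<kappa> p Q s \<Longrightarrow> \<exists>t s'. exec W p s t s' \<and> t \<le> T \<and> Q s'"
    and "unroll W e (wp W \<kappa> p) Q k s"
  shows "\<exists>t s'. exec W (While e p) s t s' \<and> t \<le> 1 + etime e + k * (1 + etime e + T) \<and> Q s'"
  using assms(2)
proof (induction k arbitrary: s)
  case 0
  then show ?case using exec.WhileFalse[of W s e p] eval_val by fastforce
next
  case (Suc k)
  then have fits: "fits W s e" by simp
  show ?case
  proof (cases "val s e = 0")
    case True
    then show ?thesis using Suc.prems exec.WhileFalse[of W s e p] eval_val[OF fits] by fastforce
  next
    case False
    then have "wp W \<kappa> p (unroll W e (wp W \<kappa> p) Q k) s" using Suc.prems by simp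
    from body[OF this] obtain t1 s1 where
      first: "exec W p s t1 s1" "t1 \<le> T" "unroll W e (wp W \<kappa> p) Q k s1" by blast
    from Suc.IH[OF first(3)] obtain t2 s2 where rest: "exec W (While e p) s1 t2 s2"
      "t2 \<le> 1 + etime e + k * (1 + etime e + T)" "Q s2" by blast
    have "exec W (While e p) s (1 + etime e + t1 + t2) s2"
      using exec.WhileTrue[OF eval_val[OF fits] False first(1) rest(1)] .
    then show ?thesis
      using first rest by (intro exI[of _ "1 + etime e + t1 + t2"] exI[of _ s2]) auto
  qed
qed

lemma wp_sound:
  "wp W \<kappa> p Q s \<Longrightarrow> \<exists>t s'. exec W p s t s' \<and> t \<le> time_bound \<kappa> p \<and> Q s'"
proof (induction p arbitrary: Q s)
  case Skip
  then show ?case using exec.Skip by fastforce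
next
  case (Assign x e)
  then show ?case using exec.Assign[OF eval_val] by fastforce
next
  case (Store e1 e2)
  then show ?case using exec.Store[OF eval_val eval_val] by fastforce
next
  case (Seq p1 p2)
  from Seq.prems Seq.IH(1) obtain t1 s1 where
    first: "exec W p1 s t1 s1" "t1 \<le> time_bound \<kappa> p1" "wp W \<kappa> p2 Q s1" by fastforce
  from Seq.IH(2)[OF first(3)] obtain t2 s2 where
    rest: "exec W p2 s1 t2 s2" "t2 \<le> time_bound \<kappa> p2" "Q s2" by blast
  then show ?case using exec.Seq[OF first(1) rest(1)] first rest by fastforce
next
  case (Cond e p1 p2)
  then have fits: "fits W s e" by simp
  show ?case
  proof (cases "val s e = 0")
    case True
    then obtain t s' where "exec W p2 s t s'" "t \<le> time_bound \<kappa> p2" "Q s'"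
      using Cond.prems Cond.IH(2) by fastforce
    then show ?thesis using exec.CondFalse[of W s e p2 t s' p1] eval_val[OF fits] True by fastforce
  next
    case False
    then obtain t s' where "exec W p1 s t s'" "t \<le> time_bound \<kappa> p1" "Q s'"
      using Cond.prems Cond.IH(1) by fastforce
    then show ?thesis using exec.CondTrue[OF eval_val[OF fits] False] by fastforce
  qed
next
  case (While e p)
  then show ?case using exec_While_unroll[OF While.IH While.prems[unfolded wp.simps]] by simp
qed

lemma wp_While:
  fixes pot :: "'g \<Rightarrow> real"
  assumes init: "Inv g s" "pot g < real (\<kappa> e) + 1"
    and nonneg: "\<And>g s. Inv g s \<Longrightarrow> 0 \<le> pot g"
    and fits: "\<And>g s. Inv g s \<Longrightarrow> fits W s e"
    and exit: "\<And>g s. Inv g s \<Longrightarrow> val s e = 0 \<Longrightarrow> Q s"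
    and body: "\<And>g s. Inv g s \<Longrightarrow> val s e \<noteq> 0 \<Longrightarrow>
      wp W \<kappa> p (\<lambda>s'. \<exists>g'. Inv g' s' \<and> pot g' + 1 \<le> pot g) s"
  shows "wp W \<kappa> (While e p) Q s"
proof -
  have "Inv g s \<Longrightarrow> pot g < real k + 1 \<Longrightarrow> unroll W e (wp W \<kappa> p) Q k s" for k g s
  proof (induction k arbitrary: g s)
    case 0
    have "val s e = 0"
    proof (rule ccontr)
      assume "val s e \<noteq> 0"
      from body[OF 0(1) this] have "wp W \<kappa> p (\<lambda>_. False) s"
        by (rule wp_mono) (use 0(2) nonneg in force)
      then show False using wp_sound by fastforce
    qed
    then show ?case using 0 fits exit by simp
  next
    case (Suc k)
    have "wp W \<kappa> p (unroll W e (wp W \<kappa> p) Q k) s" if "val s e \<noteq> 0"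
      using body[OF Suc.prems(1) that]
    proof (rule wp_mono)
      fix s' assume "\<exists>g'. Inv g' s' \<and> pot g' + 1 \<le> pot g"
      then obtain g' where "Inv g' s'" "pot g' < real k + 1" using Suc.prems(2) by force
      then show "unroll W e (wp W \<kappa> p) Q k s'" by (rule Suc.IH)
    qed
    then show ?case using Suc.prems fits exit by simp
  qed
  then show ?thesis using init by simp
qed

lemma time_bound_le:
  assumes "\<And>e. e \<in> guards p \<Longrightarrow> \<kappa> e \<le> K" "K \<ge> 1"
  shows "time_bound \<kappa> p \<le> time_bound (\<lambda>_. 1) p * K ^ loop_depth p"
  using assms(1)
proof (induction p)
  case (Seq p1 p2)
  let ?d = "max (loop_depth p1) (loop_depth p2)"
  have "time_bound \<kappa> p1 \<le> time_bound (\<lambda>_. 1) p1 * K ^ ?d"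
    "time_bound \<kappa> p2 \<le> time_bound (\<lambda>_. 1) p2 * K ^ ?d"
    using Seq \<open>K \<ge> 1\<close> by (auto elim!: order_trans intro!: power_increasing)
  moreover have "1 \<le> K ^ ?d" using \<open>K \<ge> 1\<close> by (rule one_le_power)
  ultimately show ?case by (simp add: algebra_simps)
next
  case (Cond e p1 p2)
  let ?d = "max (loop_depth p1) (loop_depth p2)"
  let ?m = "max (time_bound (\<lambda>_. 1) p1) (time_bound (\<lambda>_. 1) p2)"
  have "time_bound \<kappa> p1 \<le> ?m * K ^ ?d" "time_bound \<kappa> p2 \<le> ?m * K ^ ?d"
    using Cond \<open>K \<ge> 1\<close> by (auto elim!: order_trans intro!: mult_mono power_increasing)
  moreover have "1 + etime e \<le> (1 + etime e) * K ^ ?d"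
    using mult_le_mono2[OF one_le_power[OF \<open>K \<ge> 1\<close>]] by (metis mult_1_right)
  ultimately have "1 + etime e + max (time_bound \<kappa> p1) (time_bound \<kappa> p2) \<le>
      (1 + etime e) * K ^ ?d + ?m * K ^ ?d"
    by linarith
  then show ?case by (simp add: add_mult_distrib)
next
  case (While e p)
  let ?d = "loop_depth p" let ?t = "time_bound (\<lambda>_. 1) p"
  have "time_bound \<kappa> p \<le> ?t * K ^ ?d" using While by simp
  moreover have g: "1 + etime e \<le> (1 + etime e) * K ^ ?d"
    using mult_le_mono2[OF one_le_power[OF \<open>K \<ge> 1\<close>]] by (metis mult_1_right)
  ultimately have "1 + etime e + time_bound \<kappa> p \<le> (1 + etime e + ?t) * K ^ ?d"
    unfolding add_mult_distrib by linarith
  then have "\<kappa> e * (1 + etime e + time_bound \<kappa> p) \<le> K * ((1 + etime e + ?t) * K ^ ?d)"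
    using While.prems[of e] by (intro mult_mono) auto
  moreover have "(1 + etime e) * K ^ ?d \<le> (1 + etime e) * K ^ Suc ?d"
    using \<open>K \<ge> 1\<close> by (intro mult_le_mono2 power_increasing) auto
  ultimately show ?case using g by (simp add: algebra_simps)
qed (use \<open>K \<ge> 1\<close> in auto)

section \<open>Derived commands\<close>

notation Seq (infixr ";;" 60)

definition For :: "nat \<Rightarrow> nat \<Rightarrow> prog \<Rightarrow> prog" where
  "For x y p = Assign x (Num 0) ;;
     While (Op Monus (Reg y) (Reg x)) (p ;; Assign x (Op Plus (Reg x) (Num 1)))"

lemma guards_For [simp]: "guards (For x y p) = insert (Op Monus (Reg y) (Reg x)) (guards p)"
  by (simp add: For_def)

lemma wp_For:
  assumes init: "Inv 0 (s\<lparr>regs := (regs s)(x := 0)\<rparr>)" and "x \<noteq> y"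
    and bound: "\<And>i s. i \<le> k \<Longrightarrow> Inv i s \<Longrightarrow> regs s y = k"
    and trips: "k \<le> \<kappa> (Op Monus (Reg y) (Reg x))" "k < W" "1 < W"
    and body: "\<And>i s. i < k \<Longrightarrow> regs s x = i \<Longrightarrow> Inv i s \<Longrightarrow>
      wp W \<kappa> p (\<lambda>s'. regs s' x = i \<and> Inv (Suc i) (s'\<lparr>regs := (regs s')(x := Suc i)\<rparr>)) s"
    and final: "\<And>s. Inv k s \<Longrightarrow> Q s"
  shows "wp W \<kappa> (For x y p) Q s"
proof -
  let ?e = "Op Monus (Reg y) (Reg x)" and ?inc = "Assign x (Op Plus (Reg x) (Num 1))"
  define Inv' where "Inv' i s \<longleftrightarrow> i \<le> k \<and> regs s x = i \<and> Inv i s" for i s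
  have "wp W \<kappa> (While ?e (p ;; ?inc)) Q (s\<lparr>regs := (regs s)(x := 0)\<rparr>)"
  proof (rule wp_While[where Inv = Inv' and g = 0 and pot = "\<lambda>i. real (k - i)"])
    fix i s assume inv: "Inv' i s"
    then have y: "regs s y = k" using bound unfolding Inv'_def by blast
    show "fits W s ?e" using inv y trips by (auto simp: Inv'_def)
    show "Q s" if "val s ?e = 0" using inv y that final by (auto simp: Inv'_def)
    show "wp W \<kappa> (p ;; ?inc) (\<lambda>s'. \<exists>i'. Inv' i' s' \<and> real (k - i') + 1 \<le> real (k - i)) s"
      if "val s ?e \<noteq> 0"
    proof (rule wp_SeqI)
      have "i < k" using inv y that by (simp add: Inv'_def)
      then show "wp W \<kappa> p (\<lambda>s'. regs s' x = i \<and> Inv (Suc i) (s'\<lparr>regs := (regs s')(x := Suc i)\<rparr>)) s"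
        using inv by (intro body) (simp_all add: Inv'_def)
      fix s' assume "regs s' x = i \<and> Inv (Suc i) (s'\<lparr>regs := (regs s')(x := Suc i)\<rparr>)"
      then show "wp W \<kappa> ?inc (\<lambda>s'. \<exists>i'. Inv' i' s' \<and> real (k - i') + 1 \<le> real (k - i)) s'"
        using \<open>i < k\<close> trips by (auto simp: Inv'_def intro!: exI[of _ "Suc i"])
    qed
  qed (use init trips in \<open>auto simp: Inv'_def\<close>)
  then show ?thesis using trips by (simp add: For_def)
qed

definition Neg :: "expr \<Rightarrow> expr" where
  "Neg a = Op Monus (Num 1) a"

definition Conj :: "expr \<Rightarrow> expr \<Rightarrow> expr" where
  "Conj a b = Neg (Op Plus (Neg a) (Neg b))"

definition Disj :: "expr \<Rightarrow> expr \<Rightarrow> expr" where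
  "Disj a b = Neg (Conj (Neg a) (Neg b))"

definition Neq :: "expr \<Rightarrow> expr \<Rightarrow> expr" where
  "Neq a b = Op Plus (Op Monus a b) (Op Monus b a)"

definition Mod :: "expr \<Rightarrow> expr \<Rightarrow> expr" where
  "Mod a b = Op Monus a (Op Times (Op Quot a b) b)"

lemma val_derived [simp]:
  "val s (Neg a) = of_bool (val s a = 0)"
  "val s (Conj a b) = of_bool (val s a \<noteq> 0 \<and> val s b \<noteq> 0)"
  "val s (Disj a b) = of_bool (val s a \<noteq> 0 \<or> val s b \<noteq> 0)"
  "val s (Neq a b) = 0 \<longleftrightarrow> val s a = val s b"
  "0 < val s (Neq a b) \<longleftrightarrow> val s a \<noteq> val s b"
  "val s (Mod a b) = val s a mod val s b"
  by (auto simp: Neg_def Conj_def Disj_def Neq_def Mod_def minus_div_mult_eq_mod)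

lemma fits_derived [simp]:
  assumes "2 < W"
  shows "fits W s (Neg a) \<longleftrightarrow> fits W s a"
    and "fits W s (Conj a b) \<longleftrightarrow> fits W s a \<and> fits W s b"
    and "fits W s (Disj a b) \<longleftrightarrow> fits W s a \<and> fits W s b"
    and "fits W s (Neq a b) \<longleftrightarrow> fits W s a \<and> fits W s b"
    and "fits W s (Mod a b) \<longleftrightarrow> fits W s a \<and> fits W s b"
proof -
  have less: "fits W s e \<Longrightarrow> val s e < W" for e by (cases e) auto
  show "fits W s (Mod a b) \<longleftrightarrow> fits W s a \<and> fits W s b"
    using less[of a]
    by (auto simp: Mod_def
        intro: le_less_trans[OF div_le_dividend] le_less_trans[OF div_times_less_eq_dividend])
  show "fits W s (Neq a b) \<longleftrightarrow> fits W s a \<and> fits W s b"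
    using less[of a] less[of b] by (auto simp: Neq_def)
  show neg: "fits W s (Neg a) \<longleftrightarrow> fits W s a" for a
    using assms by (simp add: Neg_def less_imp_diff_less)
  show conj: "fits W s (Conj a b) \<longleftrightarrow> fits W s a \<and> fits W s b" for a b
    using assms by (simp add: Conj_def neg)
  show "fits W s (Disj a b) \<longleftrightarrow> fits W s a \<and> fits W s b" by (simp add: Disj_def neg conj)
qed

section \<open>The program\<close>

abbreviation agree_below :: "nat \<Rightarrow> (nat \<Rightarrow> 'a) \<Rightarrow> (nat \<Rightarrow> 'a) \<Rightarrow> bool" where
  "agree_below k f g \<equiv> \<forall>i<k. f i = g i"

abbreviation agree_except :: "'a \<Rightarrow> ('a \<Rightarrow> 'b) \<Rightarrow> ('a \<Rightarrow> 'b) \<Rightarrow> bool" where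
  "agree_except x f g \<equiv> \<forall>i. i \<noteq> x \<longrightarrow> f i = g i"

text \<open>Registers are numbered such that every subprogram changes only registers from some number on.\<close>

abbreviation (input) "r_vars \<equiv> 0 :: nat"
abbreviation (input) "r_constraints \<equiv> 1 :: nat"
abbreviation (input) "r_rows \<equiv> 2 :: nat"
abbreviation (input) "r_base \<equiv> 3 :: nat"
abbreviation (input) "r_best \<equiv> 4 :: nat"
abbreviation (input) "r_constraint \<equiv> 5 :: nat"
abbreviation (input) "r_position \<equiv> 6 :: nat"
abbreviation (input) "r_total \<equiv> 7 :: nat"
abbreviation (input) "r_arity \<equiv> 8 :: nat"
abbreviation (input) "r_size \<equiv> 9 :: nat"
abbreviation (input) "r_bottom \<equiv> 10 :: nat"
abbreviation (input) "r_height \<equiv> 11 :: nat"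
abbreviation (input) "r_found \<equiv> 12 :: nat"
abbreviation (input) "r_first \<equiv> 13 :: nat"
abbreviation (input) "r_entry \<equiv> 14 :: nat"
abbreviation (input) "r_ok \<equiv> 15 :: nat"
abbreviation (input) "r_code \<equiv> 16 :: nat"
abbreviation (input) "r_index \<equiv> 17 :: nat"
abbreviation (input) "r_digit \<equiv> 18 :: nat"
abbreviation (input) "r_name \<equiv> 19 :: nat"
abbreviation (input) "r_cost \<equiv> 20 :: nat"

text \<open>Behind the input, the memory is a matrix whose column for the variable named \<open>v\<close> starts at
  \<open>base + v * rows\<close>; thus no table of variable names is needed. Row 0 is the current node, row 1 the
  best leaf, and the stack of nodes starts at row 2. A free variable is coded as \<open>q + 1\<close>.\<close>

definition Addr :: "expr \<Rightarrow> expr \<Rightarrow> expr" where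
  "Addr v l = Op Plus (Op Plus (Reg r_base) (Op Times v (Reg r_rows))) l"

definition Cell :: "expr \<Rightarrow> expr \<Rightarrow> expr" where
  "Cell v l = Mem (Addr v l)"

definition VarName :: expr where
  "VarName = Mem (Op Plus (Num 2) (Reg r_index))"

definition Top :: expr where
  "Top = Op Plus (Reg r_height) (Num 2)"

definition copy_row :: "expr \<Rightarrow> expr \<Rightarrow> prog" where
  "copy_row dst src = For r_index r_vars (Store (Addr VarName dst) (Cell VarName src))"

definition write_digit :: "nat \<Rightarrow> prog" where
  "write_digit q =
     Assign r_digit (Mod (Reg r_code) (Num (q + 1))) ;;
     Assign r_code (Op Quot (Reg r_code) (Num (q + 1))) ;;
     Assign r_name
       (Mem (Op Monus (Op Plus (Reg r_position) (Op Plus (Reg r_arity) (Num 1))) (Reg r_index))) ;;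
     Store (Addr (Reg r_name) Top) (Reg r_digit) ;;
     Cond (Conj (Neq (Cell (Reg r_name) (Num 0)) (Num (q + 1)))
                (Neq (Cell (Reg r_name) (Num 0)) (Reg r_digit)))
       (Assign r_ok (Num 0)) Skip"

text \<open>The refinement of the current node is written above the top of the stack even if the entry turns
  out to be incompatible.\<close>

definition write_refinement :: "nat \<Rightarrow> prog" where
  "write_refinement q =
     copy_row Top (Num 0) ;;
     Assign r_ok (Num 1) ;;
     Assign r_code (Reg r_entry) ;;
     For r_index r_arity (write_digit q)"

definition push_compatible :: prog where
  "push_compatible =
     Assign r_cost (Op Plus
       (Mem (Op Plus (Reg r_position) (Op Plus (Op Plus (Num 2) (Reg r_arity)) (Reg r_entry))))
       (Num 1)) ;;
     Cond (Reg r_ok)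
       (Cond (Conj (Conj (Reg r_first) (Neg (Reg r_found))) (Neq (Reg r_cost) (Reg r_first)))
         (Assign r_found (Num 1))
         (Assign r_height (Op Plus (Reg r_height) (Num 1)) ;;
          Cond (Reg r_first) Skip (Assign r_first (Reg r_cost))))
       Skip"

definition multiply_size :: "nat \<Rightarrow> prog" where
  "multiply_size q = Assign r_size (Op Times (Reg r_size) (Num (q + 1)))"

definition load_constraint :: "nat \<Rightarrow> prog" where
  "load_constraint q =
     Assign r_arity (Mem (Reg r_position)) ;;
     Assign r_size (Num 1) ;;
     For r_index r_arity (multiply_size q) ;;
     Assign r_bottom (Reg r_height) ;;
     Assign r_first (Num 0)"

definition skip_constraint :: prog where
  "skip_constraint =
     Assign r_height (Reg r_bottom) ;;
     Assign r_total (Op Plus (Reg r_total)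
       (Op Times (Mem (Op Plus (Reg r_position) (Num 1))) (Op Monus (Reg r_first) (Num 1)))) ;;
     Assign r_position
       (Op Plus (Op Plus (Reg r_position) (Num 2)) (Op Plus (Reg r_arity) (Reg r_size)))"

text \<open>Children are pushed while the table is scanned; if no entry is discarded, the stack is reset to
  its old height.\<close>

definition scan_entry :: "nat \<Rightarrow> prog" where
  "scan_entry q = write_refinement q ;; push_compatible"

definition scan_table :: "nat \<Rightarrow> prog" where
  "scan_table q = For r_entry r_size (scan_entry q)"

definition finish_constraint :: prog where
  "finish_constraint = Cond (Reg r_found) Skip skip_constraint"

definition scan_constraint :: "nat \<Rightarrow> prog" where
  "scan_constraint q = load_constraint q ;; scan_table q ;; finish_constraint"

definition scan_constraints :: "nat \<Rightarrow> prog" where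
  "scan_constraints q =
     For r_constraint r_constraints (Cond (Reg r_found) Skip (scan_constraint q))"

definition pop_node :: prog where
  "pop_node =
     Assign r_height (Op Monus (Reg r_height) (Num 1)) ;;
     copy_row (Num 0) Top ;;
     Assign r_total (Num 0) ;;
     Assign r_found (Num 0) ;;
     Assign r_position (Op Plus (Num 2) (Reg r_vars))"

definition count_wildcard :: prog where
  "count_wildcard =
     Cond (Cell VarName (Num 0)) Skip (Assign r_total (Op Plus (Reg r_total) (Num 1)))"

definition count_wildcards :: prog where
  "count_wildcards = For r_index r_vars count_wildcard"

definition update_best :: prog where
  "update_best =
     Assign r_cost (Op Plus (Reg r_total) (Num 1)) ;;
     Cond (Disj (Neg (Reg r_best)) (Op Monus (Reg r_best) (Reg r_cost)))
       (Assign r_best (Reg r_cost) ;; copy_row (Num 1) (Num 0)) Skip"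

definition finish_node :: prog where
  "finish_node = Cond (Reg r_found) Skip (count_wildcards ;; update_best)"

definition process_node :: "nat \<Rightarrow> prog" where
  "process_node q = pop_node ;; scan_constraints q ;; finish_node"

definition mark_free :: "nat \<Rightarrow> prog" where
  "mark_free q = For r_index r_vars (Store (Addr VarName (Num 2)) (Num (q + 1)))"

definition push_root :: "nat \<Rightarrow> nat \<Rightarrow> prog" where
  "push_root q r =
     Assign r_vars (Mem (Num 0)) ;;
     Assign r_constraints (Mem (Num 1)) ;;
     Assign r_rows (Op Plus (Op Times (Reg r_vars) (Num ((q + 1) ^ r))) (Num ((q + 1) ^ r + 3))) ;;
     Assign r_base (Op Plus (Op Plus (Num 2) (Reg r_vars))
       (Op Times (Reg r_constraints) (Num (2 + r + (q + 1) ^ r)))) ;;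
     mark_free q ;;
     Assign r_height (Num 1)"

definition write_value :: "nat \<Rightarrow> prog" where
  "write_value q =
     Cond (Neq (Cell VarName (Num 1)) (Num (q + 1)))
       (Store (Reg r_index) (Cell VarName (Num 1)))
       (Store (Reg r_index) (Num 1))"

definition write_output :: "nat \<Rightarrow> prog" where
  "write_output q = For r_index r_vars (write_value q)"

definition search :: "nat \<Rightarrow> prog" where
  "search q = While (Reg r_height) (process_node q)"

definition wcsp_solver :: "nat \<Rightarrow> nat \<Rightarrow> prog" where
  "wcsp_solver q r = push_root q r ;; search q ;; write_output q"

section \<open>Memory layout\<close>

type_synonym registers = "nat \<Rightarrow> nat"

type_synonym matrix = "nat \<Rightarrow> nat \<Rightarrow> nat"

locale wcsp_ram = wcsp_enumeration +
  fixes W M :: nat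
  assumes input_le: "x \<in> set (encode q I vs cs) \<Longrightarrow> x \<le> M"
    and word_size: "(M + (q + 1) ^ r + q + r + 8) ^ 4 \<le> W"
begin

definition table_bound :: nat where
  "table_bound = (q + 1) ^ r"

definition input :: "nat list" where
  "input = encode q I vs cs"

definition table_size :: "nat set \<Rightarrow> nat" where
  "table_size C = (q + 1) ^ length (scope C)"

definition entry :: "nat set \<Rightarrow> nat \<Rightarrow> nat \<Rightarrow> nat option" where
  "entry C e = assignments q (scope C) ! e"

definition offset :: "nat \<Rightarrow> nat" where
  "offset j = 2 + length vs + (\<Sum>i<j. 2 + length (scope (cs ! i)) + table_size (cs ! i))"

definition rows :: nat where
  "rows = length vs * table_bound + table_bound + 3"

definition base :: nat where
  "base = 2 + length vs + length cs * (2 + r + table_bound)"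

definition addr :: "nat \<Rightarrow> nat \<Rightarrow> nat" where
  "addr v l = base + v * rows + l"

definition layout :: "matrix \<Rightarrow> nat \<Rightarrow> nat" where
  "layout A a = (if a < base then if a < length input then input ! a else 0
                 else A ((a - base) mod rows) ((a - base) div rows))"

definition machine :: "registers \<Rightarrow> matrix \<Rightarrow> ram" where
  "machine \<rho> A = \<lparr>regs = \<rho>, mem = layout A\<rparr>"

lemma nth_cs_constraint: "j < length cs \<Longrightarrow> cs ! j \<in># Constraints I"
  using set_cs nth_mem by blast

lemma length_encode_constraint:
  "length (encode_constraint q I vs C) = 2 + length (scope C) + table_size C"
  by (simp add: encode_constraint_def Let_def length_assignments table_size_def flip: scope_def)

lemma length_input: "length input = offset (length cs)"
  by (simp add: input_def encode_def offset_def length_concat comp_def length_encode_constraint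
      sum_list_sum_nth atLeast0LessThan)

lemma offset_Suc: "offset (Suc j) = offset j + 2 + (length (scope (cs ! j)) + table_size (cs ! j))"
  by (simp add: offset_def)

lemma offset_mono: "i \<le> j \<Longrightarrow> offset i \<le> offset j"
  unfolding offset_def by (intro add_left_mono sum_mono2) auto

lemma offset_add_less:
  assumes "j < length cs" "k < 2 + length (scope (cs ! j)) + table_size (cs ! j)"
  shows "offset j + k < length input"
  using offset_mono[of "Suc j" "length cs"] assms by (simp add: length_input offset_Suc)

lemma nth_input_offset:
  assumes "j < length cs" "k < 2 + length (scope (cs ! j)) + table_size (cs ! j)"
  shows "input ! (offset j + k) = encode_constraint q I vs (cs ! j) ! k"
proof -
  let ?enc = "encode_constraint q I vs"
  have "offset j + k =
      length ([length vs, length cs] @ vs) + ((\<Sum>i<j. length (?enc (cs ! i))) + k)"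
    by (simp add: offset_def length_encode_constraint)
  then have "input ! (offset j + k) = concat (map ?enc cs) ! ((\<Sum>i<j. length (?enc (cs ! i))) + k)"
    unfolding input_def encode_def by (simp add: nth_append)
  also have "\<dots> = ?enc (cs ! j) ! k"
    using assms by (intro nth_concat_map_offset) (simp_all add: length_encode_constraint)
  finally show ?thesis .
qed

lemma encode_constraint_scope:
  "encode_constraint q I vs C =
     [length (scope C), count (Constraints I) C] @ scope C @
     map (Cost I C) (assignments q (scope C))"
  by (simp add: encode_constraint_def Let_def scope_def)

lemma nth_input_constraint:
  assumes "j < length cs"
  shows nth_input_arity: "input ! offset j = length (scope (cs ! j))"
    and nth_input_count: "input ! (offset j + 1) = count (Constraints I) (cs ! j)"
    and nth_input_scope:
      "i < length (scope (cs ! j)) \<Longrightarrow> input ! (offset j + (2 + i)) = scope (cs ! j) ! i"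
    and nth_input_cost: "e < table_size (cs ! j) \<Longrightarrow>
      input ! (offset j + (2 + length (scope (cs ! j)) + e)) = Cost I (cs ! j) (entry (cs ! j) e)"
  using nth_input_offset[OF assms, of 0] nth_input_offset[OF assms, of 1]
    nth_input_offset[OF assms, of "2 + i"]
    nth_input_offset[OF assms, of "2 + length (scope (cs ! j)) + e"]
  by (simp_all add: encode_constraint_scope nth_append entry_def table_size_def length_assignments)

lemma nth_input_header:
  shows nth_input_vars: "input ! 0 = length vs"
    and nth_input_constraints: "input ! 1 = length cs"
    and nth_input_name: "i < length vs \<Longrightarrow> input ! (2 + i) = vs ! i"
  by (auto simp: input_def encode_def nth_append)

lemma header_less:
  shows one_less_length_input: "1 < length input"
    and name_less_length_input: "i < length vs \<Longrightarrow> 2 + i < length input"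
  by (auto simp: input_def encode_def)

lemma table_size_le: "C \<in># Constraints I \<Longrightarrow> table_size C \<le> table_bound"
  unfolding table_size_def table_bound_def by (intro power_increasing length_scope_le) auto

lemma length_input_le: "length input \<le> base"
proof -
  have "(\<Sum>i<length cs. 2 + length (scope (cs ! i)) + table_size (cs ! i)) \<le>
      (\<Sum>i<length cs. 2 + r + table_bound)"
    using table_size_le length_scope_le nth_cs_constraint by (intro sum_mono add_mono) auto
  then show ?thesis unfolding length_input offset_def base_def by simp
qed

lemma layout_input: "a < length input \<Longrightarrow> layout A a = input ! a"
  using length_input_le by (simp add: layout_def)

lemma rows_pos: "rows > 0"
  by (simp add: rows_def)

lemma layout_addr: "l < rows \<Longrightarrow> layout A (addr v l) = A l v"
  by (simp add: layout_def addr_def)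

lemma layout_upd:
  assumes l: "l < rows"
  shows "(layout A)(addr v l := x) = layout (A(l := (A l)(v := x)))"
proof
  fix a
  show "((layout A)(addr v l := x)) a = layout (A(l := (A l)(v := x))) a"
  proof (cases "a < base")
    case False
    have "a = addr v l \<longleftrightarrow> (a - base) mod rows = l \<and> (a - base) div rows = v"
      using False l div_mult_mod_eq[of "a - base" rows] by (auto simp: addr_def)
    then show ?thesis using False by (auto simp: layout_def)
  qed (auto simp: layout_def addr_def)
qed

lemma machine_simps [simp]:
  "regs (machine \<rho> A) = \<rho>" "mem (machine \<rho> A) = layout A"
  "(machine \<rho> A)\<lparr>regs := \<rho>'\<rparr> = machine \<rho>' A"
  by (simp_all add: machine_def)

lemma machine_store:
  "l < rows \<Longrightarrow>
     (machine \<rho> A)\<lparr>mem := (layout A)(addr v l := x)\<rparr> = machine \<rho> (A(l := (A l)(v := x)))"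
  by (simp add: machine_def layout_upd)

text \<open>All numbers that occur are at most cubic in this one.\<close>

definition magnitude :: nat where
  "magnitude = M + table_bound + q + r + 8"

lemma magnitude_bounds:
  "length vs + 8 \<le> magnitude" "length cs + 8 \<le> magnitude" "M + 8 \<le> magnitude"
  "table_bound + 8 \<le> magnitude" "r + table_bound + 8 \<le> magnitude" "q + 8 \<le> magnitude"
proof -
  have "length vs \<le> M" "length cs \<le> M" by (intro input_le, simp add: encode_def)+
  then show "length vs + 8 \<le> magnitude" "length cs + 8 \<le> magnitude" "M + 8 \<le> magnitude"
    "table_bound + 8 \<le> magnitude" "r + table_bound + 8 \<le> magnitude" "q + 8 \<le> magnitude"
    by (simp_all add: magnitude_def)
qed

lemma magnitude_cube_less: "3 * magnitude ^ 3 < W"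
proof -
  have "3 * magnitude ^ 3 < magnitude * magnitude ^ 3"
    using magnitude_bounds by (intro mult_strict_right_mono) auto
  also have "\<dots> = magnitude ^ 4" by (simp add: eval_nat_numeral)
  also have "\<dots> \<le> W" using word_size by (simp only: magnitude_def table_bound_def)
  finally show ?thesis .
qed

lemma magnitude_le_powers: "magnitude \<le> magnitude ^ 2" "magnitude ^ 2 \<le> magnitude ^ 3"
  using magnitude_bounds by (simp_all add: eval_nat_numeral)

lemma matrix_less: "base + (M + 1) * rows < W"
proof -
  have "length cs * (2 + r + table_bound) \<le> magnitude * magnitude"
    using magnitude_bounds by (intro mult_mono) auto
  moreover have "rows \<le> (length vs + 1) * (table_bound + 3)" by (simp add: rows_def)
  then have "rows \<le> magnitude * magnitude"
    by (rule order_trans) (use magnitude_bounds in \<open>intro mult_mono; simp\<close>)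
  then have "(M + 1) * rows \<le> magnitude * (magnitude * magnitude)"
    using magnitude_bounds by (intro mult_mono) auto
  moreover have "2 + length vs \<le> magnitude" using magnitude_bounds by simp
  ultimately have "base + (M + 1) * rows \<le> magnitude + magnitude ^ 2 + magnitude ^ 3"
    unfolding base_def by (simp add: power2_eq_square power3_eq_cube)
  also have "\<dots> < W" using magnitude_le_powers magnitude_cube_less by linarith
  finally show ?thesis .
qed

lemma cost_less: "length cs * (M * M) + length vs + 2 < W"
proof -
  have "length cs * (M * M) \<le> magnitude * (magnitude * magnitude)"
    using magnitude_bounds by (intro mult_mono) auto
  then have "length cs * (M * M) + length vs + 2 \<le> magnitude ^ 3 + magnitude"
    using magnitude_bounds by (simp add: power3_eq_cube)
  also have "\<dots> < W" using magnitude_le_powers magnitude_cube_less by linarith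
  finally show ?thesis .
qed

lemma word_limits:
  shows base_less_word: "base < W" and rows_less_word: "rows < W"
    and input_less_word: "M + 1 < W"
    and vars_less_word: "length vs < W" and constraints_less_word: "length cs < W"
    and table_less_word: "r + table_bound + 5 < W" and symbols_less_word: "q + 1 < W"
proof -
  have "rows \<le> (M + 1) * rows" by simp
  then show "base < W" "rows < W" using matrix_less by linarith+
  have "magnitude < W" using magnitude_le_powers magnitude_cube_less by linarith
  then show "M + 1 < W" "length vs < W" "length cs < W" "r + table_bound + 5 < W" "q + 1 < W"
    using magnitude_bounds by linarith+
qed

lemma addr_less: "v \<le> M \<Longrightarrow> l < rows \<Longrightarrow> addr v l < W"
proof -
  assume "v \<le> M" "l < rows"
  then have "v * rows + l \<le> M * rows + rows" by (intro add_mono mult_right_mono) auto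
  then show ?thesis using matrix_less by (simp add: addr_def)
qed

lemma Vars_le: "v \<in> Vars I \<Longrightarrow> v \<le> M"
  unfolding set_vs[symmetric] by (rule input_le) (simp add: encode_def)

lemma nth_vs: "i < length vs \<Longrightarrow> vs ! i \<in> Vars I"
  using nth_mem[of i vs] by (simp add: set_vs)

section \<open>Execution of subprograms\<close>

definition max_nodes :: nat where
  "max_nodes = nat \<lfloor>branch_base q r ^ length vs * (real (length vs) + 1)\<rfloor>"

definition max_trips :: nat where
  "max_trips = length vs + length cs + r + table_bound"

text \<open>Only the search loop has a bare register as its guard.\<close>

definition trips :: "expr \<Rightarrow> nat" where
  "trips e = (if e = Reg r_height then max_nodes else max_trips)"

definition runs :: "prog \<Rightarrow> registers \<Rightarrow> matrix \<Rightarrow>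
    (registers \<Rightarrow> matrix \<Rightarrow> bool) \<Rightarrow> bool" where
  "runs p \<rho> A Q \<longleftrightarrow> wp W trips p (\<lambda>s. \<exists>\<rho> A. s = machine \<rho> A \<and> Q \<rho> A) (machine \<rho> A)"

definition globals :: "registers \<Rightarrow> bool" where
  "globals \<rho> \<longleftrightarrow> \<rho> r_vars = length vs \<and> \<rho> r_constraints = length cs \<and>
     \<rho> r_rows = rows \<and> \<rho> r_base = base"

lemma globals_upd [simp]: "r_best \<le> x \<Longrightarrow> globals (\<rho>(x := k)) \<longleftrightarrow> globals \<rho>"
  by (simp add: globals_def)

lemma globals_cong: "globals \<rho> \<Longrightarrow> (\<And>y. y < r_best \<Longrightarrow> \<rho>' y = \<rho> y) \<Longrightarrow> globals \<rho>'"
  by (simp add: globals_def)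

lemma runs_mono: "runs p \<rho> A Q \<Longrightarrow> (\<And>\<rho> A. Q \<rho> A \<Longrightarrow> R \<rho> A) \<Longrightarrow> runs p \<rho> A R"
  unfolding runs_def by (erule wp_mono) blast

lemma runs_Skip: "Q \<rho> A \<Longrightarrow> runs Skip \<rho> A Q"
  unfolding runs_def by auto

lemma runs_Assign:
  "fits W (machine \<rho> A) e \<Longrightarrow> Q (\<rho>(x := val (machine \<rho> A) e)) A \<Longrightarrow> runs (Assign x e) \<rho> A Q"
  unfolding runs_def by auto

lemma runs_Seq: "runs p1 \<rho> A (\<lambda>\<rho> A. runs p2 \<rho> A Q) \<Longrightarrow> runs (p1 ;; p2) \<rho> A Q"
  unfolding runs_def by (erule wp_SeqI) blast

lemma runs_SeqI:
  "runs p1 \<rho> A Q \<Longrightarrow> (\<And>\<rho> A. Q \<rho> A \<Longrightarrow> runs p2 \<rho> A R) \<Longrightarrow> runs (p1 ;; p2) \<rho> A R"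
  by (rule runs_Seq) (rule runs_mono)

lemma runs_Cond:
  assumes "fits W (machine \<rho> A) e"
    and "val (machine \<rho> A) e \<noteq> 0 \<Longrightarrow> runs p1 \<rho> A Q" "val (machine \<rho> A) e = 0 \<Longrightarrow> runs p2 \<rho> A Q"
  shows "runs (Cond e p1 p2) \<rho> A Q"
  using assms unfolding runs_def by auto

lemma word_limits_simps [simp]:
  "0 < W" "Suc 0 < W" "2 < W" "length vs < W" "length cs < W" "q < W" "Suc q < W"
  using word_limits by linarith+

lemma runs_For:
  assumes init: "Inv 0 (\<rho>(x := 0)) A" and "x \<noteq> y"
    and bound: "\<And>i \<rho> A. i \<le> k \<Longrightarrow> Inv i \<rho> A \<Longrightarrow> \<rho> y = k" and trips: "k \<le> max_trips" "k < W"
    and body: "\<And>i \<rho> A. i < k \<Longrightarrow> \<rho> x = i \<Longrightarrow> Inv i \<rho> A \<Longrightarrow>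
      runs p \<rho> A (\<lambda>\<rho>' A'. \<rho>' x = i \<and> Inv (Suc i) (\<rho>'(x := Suc i)) A')"
    and final: "\<And>\<rho> A. Inv k \<rho> A \<Longrightarrow> Q \<rho> A"
  shows "runs (For x y p) \<rho> A Q"
  unfolding runs_def
proof (rule wp_For[where Inv = "\<lambda>i s. \<exists>\<rho> A. s = machine \<rho> A \<and> Inv i \<rho> A" and k = k])
  show "\<exists>\<rho>' A'. (machine \<rho> A)\<lparr>regs := (regs (machine \<rho> A))(x := 0)\<rparr> = machine \<rho>' A' \<and> Inv 0 \<rho>' A'"
    using init by auto
  fix i s assume i: "i < k" "regs s x = i" and "\<exists>\<rho> A. s = machine \<rho> A \<and> Inv i \<rho> A"
  then obtain \<rho> A where s: "s = machine \<rho> A" "Inv i \<rho> A" by blast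
  then have "wp W trips p (\<lambda>s. \<exists>\<rho> A. s = machine \<rho> A \<and> \<rho> x = i \<and> Inv (Suc i) (\<rho>(x := Suc i)) A) s"
    using body[of i \<rho> A] i by (simp add: runs_def)
  then show "wp W trips p (\<lambda>s'. regs s' x = i \<and>
      (\<exists>\<rho> A. s'\<lparr>regs := (regs s')(x := Suc i)\<rparr> = machine \<rho> A \<and> Inv (Suc i) \<rho> A)) s"
    by (rule wp_mono) (auto intro!: exI)
next
  show "\<exists>\<rho> A. s = machine \<rho> A \<and> Q \<rho> A" if "\<exists>\<rho> A. s = machine \<rho> A \<and> Inv k \<rho> A" for s
    using that final by blast
qed (use bound trips \<open>x \<noteq> y\<close> in \<open>auto simp: trips_def\<close>)

lemma val_Addr [simp]:
  "globals \<rho> \<Longrightarrow> val (machine \<rho> A) (Addr v l) = addr (val (machine \<rho> A) v) (val (machine \<rho> A) l)"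
  by (simp add: Addr_def addr_def globals_def)

lemma fits_Addr [simp]:
  assumes "globals \<rho>" "fits W (machine \<rho> A) v" "fits W (machine \<rho> A) l"
    and "val (machine \<rho> A) v \<le> M" "val (machine \<rho> A) l < rows"
  shows "fits W (machine \<rho> A) (Addr v l)"
  using addr_less[OF assms(4,5)] assms rows_less_word by (simp add: Addr_def addr_def globals_def)

lemma val_Cell [simp]:
  "globals \<rho> \<Longrightarrow> val (machine \<rho> A) l < rows \<Longrightarrow>
     val (machine \<rho> A) (Cell v l) = A (val (machine \<rho> A) l) (val (machine \<rho> A) v)"
  by (simp add: Cell_def layout_addr)

lemma fits_Cell [simp]:
  assumes "globals \<rho>" "fits W (machine \<rho> A) v" "fits W (machine \<rho> A) l"
    and "val (machine \<rho> A) v \<le> M" "val (machine \<rho> A) l < rows"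
    and "A (val (machine \<rho> A) l) (val (machine \<rho> A) v) < W"
  shows "fits W (machine \<rho> A) (Cell v l)"
  using assms by (simp add: Cell_def layout_addr)

lemma val_fits_VarName [simp]:
  assumes "\<rho> r_index < length vs"
  shows "val (machine \<rho> A) VarName = vs ! \<rho> r_index" "fits W (machine \<rho> A) VarName"
proof -
  have layout: "layout A (2 + \<rho> r_index) = vs ! \<rho> r_index"
    using layout_input[OF name_less_length_input[OF assms], of A] nth_input_name[OF assms] by simp
  then show "val (machine \<rho> A) VarName = vs ! \<rho> r_index" by (simp add: VarName_def)
  have "2 + \<rho> r_index < base" using name_less_length_input[OF assms] length_input_le by simp
  then show "fits W (machine \<rho> A) VarName"
    using layout word_limits Vars_le[OF nth_vs[OF assms]] by (simp add: VarName_def)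
qed

lemma val_fits_Top [simp]:
  "val (machine \<rho> A) Top = \<rho> r_height + 2" "\<rho> r_height + 2 < rows \<Longrightarrow> fits W (machine \<rho> A) Top"
  using word_limits by (auto simp: Top_def)

lemma runs_Store_Addr:
  assumes "globals \<rho>" "fits W (machine \<rho> A) v" "fits W (machine \<rho> A) l" "fits W (machine \<rho> A) e"
    and "val (machine \<rho> A) v \<le> M" "val (machine \<rho> A) l < rows"
    and "Q \<rho> (A(val (machine \<rho> A) l :=
      (A (val (machine \<rho> A) l))(val (machine \<rho> A) v := val (machine \<rho> A) e)))"
  shows "runs (Store (Addr v l) e) \<rho> A Q"
  using assms unfolding runs_def by (auto simp: machine_store)

definition node_code :: "nat option option \<Rightarrow> nat" where
  "node_code a = (case a of None \<Rightarrow> q + 1 | Some b \<Rightarrow> symbol_code b)"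

lemma node_code_simps [simp]: "node_code None = q + 1" "node_code (Some a) = symbol_code a"
  by (simp_all add: node_code_def)

lemma node_code_le: "\<sigma> \<in> nodes \<Longrightarrow> node_code (\<sigma> v) \<le> q + 1"
  using nodes_value[of \<sigma> v] symbol_code_le by (auto simp: node_code_def le_SucI split: option.split)

lemma node_code_less: "\<sigma> \<in> nodes \<Longrightarrow> node_code (\<sigma> v) < W"
  using node_code_le symbols_less_word by (rule le_less_trans)

definition stored :: "matrix \<Rightarrow> nat \<Rightarrow> node \<Rightarrow> bool" where
  "stored A l \<sigma> \<longleftrightarrow> (\<forall>v\<in>Vars I. A l v = node_code (\<sigma> v))"

definition stored_from :: "matrix \<Rightarrow> nat \<Rightarrow> node list \<Rightarrow> bool" where
  "stored_from A l \<sigma>s \<longleftrightarrow> (\<forall>i<length \<sigma>s. stored A (l + i) (\<sigma>s ! i))"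

lemma stored_from_Nil [simp]: "stored_from A l []"
  by (simp add: stored_from_def)

lemma stored_from_singleton [simp]: "stored_from A l [\<sigma>] \<longleftrightarrow> stored A l \<sigma>"
  by (simp add: stored_from_def)

lemma stored_from_snoc:
  "stored_from A l (\<sigma>s @ [\<tau>]) \<longleftrightarrow> stored_from A l \<sigma>s \<and> stored A (l + length \<sigma>s) \<tau>"
  by (auto simp: stored_from_def nth_append less_Suc_eq)

lemma stored_from_append:
  "stored_from A l (\<sigma>s @ \<tau>s) \<longleftrightarrow> stored_from A l \<sigma>s \<and> stored_from A (l + length \<sigma>s) \<tau>s"
proof (induction \<tau>s rule: rev_induct)
  case (snoc \<tau> \<tau>s)
  then show ?case
    using stored_from_snoc[of A l "\<sigma>s @ \<tau>s" \<tau>] by (simp add: stored_from_snoc add.assoc)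
qed simp

lemma stored_from_cong:
  "(\<And>k. l \<le> k \<Longrightarrow> k < l + length \<sigma>s \<Longrightarrow> A' k = A k) \<Longrightarrow> stored_from A' l \<sigma>s \<longleftrightarrow> stored_from A l \<sigma>s"
  by (simp add: stored_from_def stored_def)

definition denotes_row :: "registers \<Rightarrow> expr \<Rightarrow> nat \<Rightarrow> bool" where
  "denotes_row \<rho> e l \<longleftrightarrow> l < rows \<and>
     (\<forall>\<rho>' A. agree_below r_index \<rho>' \<rho> \<longrightarrow> fits W (machine \<rho>' A) e \<and> val (machine \<rho>' A) e = l)"

lemma denotes_row_Num: "l < rows \<Longrightarrow> denotes_row \<rho> (Num l) l"
  using word_limits by (simp add: denotes_row_def)

lemma denotes_row_Top: "\<rho> r_height + 2 < rows \<Longrightarrow> denotes_row \<rho> Top (\<rho> r_height + 2)"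
  by (simp add: denotes_row_def)

lemma runs_copy_row:
  assumes glob: "globals \<rho>"
    and dst: "denotes_row \<rho> dst k" and src: "denotes_row \<rho> src l" and "k \<noteq> l"
    and \<sigma>: "\<sigma> \<in> nodes" "stored A l \<sigma>"
  shows "runs (copy_row dst src) \<rho> A (\<lambda>\<rho>' A'.
    agree_below r_index \<rho>' \<rho> \<and> agree_except k A' A \<and> stored A' k \<sigma>)"
  unfolding copy_row_def
proof (rule runs_For[where k = "length vs" and Inv = "\<lambda>i \<rho>' A'. agree_below r_index \<rho>' \<rho> \<and>
    agree_except k A' A \<and> (\<forall>v\<in>set (take i vs). A' k v = node_code (\<sigma> v))"])
  fix i \<rho>' A'
  assume i: "i < length vs" "\<rho>' r_index = i"
    and inv: "agree_below r_index \<rho>' \<rho> \<and> agree_except k A' A \<and>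
      (\<forall>v\<in>set (take i vs). A' k v = node_code (\<sigma> v))"
  have v: "vs ! i \<in> Vars I" "vs ! i \<le> M" using nth_vs[OF i(1)] Vars_le by auto
  have glob': "globals \<rho>'" using globals_cong[OF glob] inv by simp
  have cell: "A' l (vs ! i) = node_code (\<sigma> (vs ! i))"
    using inv \<sigma>(2) v(1) \<open>k \<noteq> l\<close> by (simp add: stored_def)
  have rows: "fits W (machine \<rho>' A') dst" "val (machine \<rho>' A') dst = k" "k < rows"
      "fits W (machine \<rho>' A') src" "val (machine \<rho>' A') src = l" "l < rows"
    using dst src inv by (auto simp: denotes_row_def)
  show "runs (Store (Addr VarName dst) (Cell VarName src)) \<rho>' A' (\<lambda>\<rho>' A'. \<rho>' r_index = i \<and>
      agree_below r_index (\<rho>'(r_index := Suc i)) \<rho> \<and> agree_except k A' A \<and>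
      (\<forall>v\<in>set (take (Suc i) vs). A' k v = node_code (\<sigma> v)))"
    using i inv glob' v rows cell node_code_less[OF \<sigma>(1)]
    by (intro runs_Store_Addr) (auto simp: take_Suc_conv_app_nth)
qed (use glob in \<open>auto simp: globals_def max_trips_def stored_def set_vs\<close>)

lemma node_code_eq_iff:
  assumes "\<sigma> \<in> nodes" "b \<in> wvalues q"
  shows "node_code (\<sigma> v) = q + 1 \<longleftrightarrow> \<sigma> v = None"
    and "node_code (\<sigma> v) = symbol_code b \<longleftrightarrow> \<sigma> v = Some b"
proof -
  have "\<sigma> v = None \<or> (\<exists>a\<in>wvalues q. \<sigma> v = Some a)"
    using nodes_value[OF assms(1), of v] by (cases "\<sigma> v") auto
  moreover have "symbol_code a \<le> q" if "a \<in> wvalues q" for a using that by (rule symbol_code_le)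
  ultimately show "node_code (\<sigma> v) = q + 1 \<longleftrightarrow> \<sigma> v = None"
    "node_code (\<sigma> v) = symbol_code b \<longleftrightarrow> \<sigma> v = Some b"
    using assms(2) by (fastforce simp: symbol_code_inj)+
qed

lemma refine_insert: "refine \<sigma> (insert v X) f = (refine \<sigma> X f)(v \<mapsto> f v)"
  by (simp add: refine_def override_on_insert)

lemma compatible_insert:
  "compatible \<sigma> (insert v X) f \<longleftrightarrow> (\<sigma> v = None \<or> \<sigma> v = Some (f v)) \<and> compatible \<sigma> X f"
  by (auto simp: compatible_def)

lemma entry_wfuns:
  assumes "C \<in># Constraints I" "e < table_size C"
  shows "entry C e \<in> wfuns q C"
  using assms set_assignments[OF distinct_scope, of q C] nth_mem[of e "assignments q (scope C)"]
  by (simp add: entry_def table_size_def length_assignments set_scope)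

definition at_constraint :: "node \<Rightarrow> nat \<Rightarrow> registers \<Rightarrow> matrix \<Rightarrow> bool" where
  "at_constraint \<sigma> j \<rho> A \<longleftrightarrow> globals \<rho> \<and> \<rho> r_position = offset j \<and>
     \<rho> r_arity = length (scope (cs ! j)) \<and> stored A 0 \<sigma>"

definition last_vars :: "nat set \<Rightarrow> nat \<Rightarrow> nat set" where
  "last_vars C t = set (take t (rev (scope C)))"

definition digits_written :: "node \<Rightarrow> nat set \<Rightarrow> nat \<Rightarrow> nat \<Rightarrow> registers \<Rightarrow> matrix \<Rightarrow> bool" where
  "digits_written \<sigma> C e t \<rho> A \<longleftrightarrow>
     \<rho> r_code = e div (q + 1) ^ t \<and> \<rho> r_ok = of_bool (compatible \<sigma> (last_vars C t) (entry C e)) \<and>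
     stored A (\<rho> r_height + 2) (refine \<sigma> (last_vars C t) (entry C e))"

lemma layout_scope:
  assumes "j < length cs" "t < length (scope (cs ! j))"
  shows "layout A (offset j + (length (scope (cs ! j)) + 1) - t) = rev (scope (cs ! j)) ! t"
proof -
  define i where "i = length (scope (cs ! j)) - Suc t"
  have i: "i < length (scope (cs ! j))" using assms by (simp add: i_def)
  have "offset j + (length (scope (cs ! j)) + 1) - t = offset j + (2 + i)"
    using assms by (simp add: i_def)
  then show ?thesis
    using layout_input[OF offset_add_less[OF assms(1), of "2 + i"], of A]
      nth_input_scope[OF assms(1) i] i assms
    by (simp add: rev_nth i_def)
qed

lemma digits_written_Suc:
  assumes \<sigma>: "\<sigma> \<in> nodes" and C: "C \<in># Constraints I" and e: "e < table_size C"
    and t: "t < length (scope C)" and v: "v = rev (scope C) ! t"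
    and inv: "digits_written \<sigma> C e t \<rho> A"
    and code: "\<rho>' r_code = e div (q + 1) ^ t div (q + 1)" and height: "\<rho>' r_height = \<rho> r_height"
    and ok: "\<rho>' r_ok =
      (if node_code (\<sigma> v) = q + 1 \<or> node_code (\<sigma> v) = symbol_code (entry C e v) then \<rho> r_ok else 0)"
  shows "digits_written \<sigma> C e (Suc t) \<rho>'
    (A(\<rho> r_height + 2 := (A (\<rho> r_height + 2))(v := symbol_code (entry C e v))))"
proof -
  have "v \<in> C" using t nth_mem[of t "rev (scope C)"] set_scope[OF C] by (simp add: v)
  then have "entry C e v \<in> wvalues q" using entry_wfuns[OF C e] by (auto simp: wfuns_def)
  note eq = node_code_eq_iff[OF \<sigma> this, of v]
  have "last_vars C (Suc t) = insert v (last_vars C t)"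
    using t by (simp add: last_vars_def take_Suc_conv_app_nth v)
  moreover have "e div (q + 1) ^ Suc t = e div (q + 1) ^ t div (q + 1)"
    by (simp only: power_Suc2 div_mult2_eq)
  ultimately show ?thesis
    using inv code height ok unfolding eq
    by (auto simp: digits_written_def compatible_insert refine_insert stored_def
        simp del: power_Suc)
qed

lemma runs_write_digit:
  assumes \<sigma>: "\<sigma> \<in> nodes" and j: "j < length cs" and e: "e < table_size (cs ! j)"
    and t: "t < length (scope (cs ! j))" "\<rho> r_index = t" and h: "\<rho> r_height + 2 < rows"
    and ctx: "at_constraint \<sigma> j \<rho> A" and inv: "digits_written \<sigma> (cs ! j) e t \<rho> A"
  shows "runs (write_digit q) \<rho> A (\<lambda>\<rho>' A'. agree_below r_ok \<rho>' \<rho> \<and> \<rho>' r_index = t \<and>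
    agree_except (\<rho> r_height + 2) A' A \<and> digits_written \<sigma> (cs ! j) e (Suc t) \<rho>' A')"
proof -
  let ?C = "cs ! j"
  define v where "v = rev (scope ?C) ! t"
  have C: "?C \<in># Constraints I" using nth_cs_constraint[OF j] .
  have "v \<in> ?C" using t nth_mem[of t "rev (scope ?C)"] set_scope[OF C] by (simp add: v_def)
  then have v: "v \<in> Vars I" "v \<le> M" "v < W"
    using constraint_subset[OF C] Vars_le word_limits by fastforce+
  have glob: "globals \<rho>" and pos: "\<rho> r_position = offset j" "\<rho> r_arity = length (scope ?C)"
    and cell: "A 0 v = node_code (\<sigma> v)"
    using ctx v(1) by (simp_all add: at_constraint_def stored_def)
  have digit: "e div Suc q ^ t mod Suc q = symbol_code (entry ?C e v)"
    using symbol_code_nth_assignments[OF distinct_scope t(1)] e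
    by (simp add: v_def entry_def table_size_def)
  moreover have "e div Suc q ^ t mod Suc q < Suc q" by simp
  ultimately have digit_less: "symbol_code (entry ?C e v) < W"
    by (metis less_trans word_limits_simps(7))
  have code: "\<rho> r_code = e div Suc q ^ t" using inv by (simp add: digits_written_def)
  have "e < W" using e table_size_le[OF C] word_limits by linarith
  then have code_less: "e div Suc q ^ t < W" "e div Suc q ^ t div Suc q < W"
    by (meson div_le_dividend le_less_trans)+
  have name: "layout A (offset j + (length (scope ?C) + 1) - t) = v"
    using layout_scope[OF j t(1)] by (simp add: v_def)
  have "offset j + (length (scope ?C) + 1) < base"
    using offset_add_less[OF j, of "length (scope ?C) + 1"] e length_input_le by simp
  then have pos_less: "offset j + (length (scope ?C) + 1) < W" using word_limits by simp
  note next_digit = digits_written_Suc[OF \<sigma> C e t(1) v_def inv, simplified]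
  show ?thesis
    unfolding write_digit_def
    using glob pos cell code code_less name pos_less v h t digit digit_less
      node_code_less[OF \<sigma>, of v] rows_pos
    by (intro runs_Seq runs_Assign runs_Store_Addr runs_Cond runs_Skip) (simp_all add: next_digit)
qed

lemma at_constraint_cong:
  "at_constraint \<sigma> j \<rho> A \<Longrightarrow> (\<And>y. y < r_size \<Longrightarrow> \<rho>' y = \<rho> y) \<Longrightarrow> A' 0 = A 0 \<Longrightarrow> at_constraint \<sigma> j \<rho>' A'"
  by (simp add: at_constraint_def globals_def stored_def)

lemma length_scope_trips:
  assumes "C \<in># Constraints I"
  shows "length (scope C) \<le> max_trips" "length (scope C) < W"
  using length_scope_le[OF assms] word_limits by (auto simp: max_trips_def)

lemma runs_write_refinement:
  assumes \<sigma>: "\<sigma> \<in> nodes" and j: "j < length cs" and e: "e < table_size (cs ! j)" "\<rho> r_entry = e"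
    and l: "l = \<rho> r_height + 2" "l < rows" and ctx: "at_constraint \<sigma> j \<rho> A"
  shows "runs (write_refinement q) \<rho> A (\<lambda>\<rho>' A'. agree_below r_ok \<rho>' \<rho> \<and> agree_except l A' A \<and>
    \<rho>' r_ok = of_bool (compatible \<sigma> (cs ! j) (entry (cs ! j) e)) \<and>
    stored A' l (refine \<sigma> (cs ! j) (entry (cs ! j) e)))" (is "runs _ _ _ ?Q")
proof -
  let ?C = "cs ! j"
  have C: "?C \<in># Constraints I" using nth_cs_constraint[OF j] .
  have glob: "globals \<rho>" and row: "stored A 0 \<sigma>" using ctx by (simp_all add: at_constraint_def)
  have "e < W" using e table_size_le[OF C] word_limits by linarith
  define Inv where "Inv t \<rho>' A' \<longleftrightarrow> agree_below r_ok \<rho>' \<rho> \<and> agree_except l A' A \<and>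
    digits_written \<sigma> ?C e t \<rho>' A'" for t \<rho>' A'
  have digits: "runs (For r_index r_arity (write_digit q)) \<rho>1 A1 ?Q"
    if init: "Inv 0 (\<rho>1(r_index := 0)) A1" for \<rho>1 A1
  proof (rule runs_For[where Inv = Inv and k = "length (scope ?C)"])
    fix t \<rho>' A' assume t: "t < length (scope ?C)" "\<rho>' r_index = t" and inv: "Inv t \<rho>' A'"
    have "at_constraint \<sigma> j \<rho>' A'" "\<rho>' r_height + 2 = l"
      using at_constraint_cong[OF ctx] inv l by (simp_all add: Inv_def)
    from runs_write_digit[OF \<sigma> j e(1) t _ this(1)] this(2) l(2) inv
    show "runs (write_digit q) \<rho>' A'
        (\<lambda>\<rho>' A'. \<rho>' r_index = t \<and> Inv (Suc t) (\<rho>'(r_index := Suc t)) A')"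
      by (auto simp: Inv_def digits_written_def elim!: runs_mono)
  next
    show "?Q \<rho>' A'" if "Inv (length (scope ?C)) \<rho>' A'" for \<rho>' A'
      using that set_scope[OF C] l by (auto simp: Inv_def digits_written_def last_vars_def)
  qed (use init length_scope_trips[OF C] ctx in \<open>auto simp: Inv_def at_constraint_def\<close>)
  show ?thesis
    unfolding write_refinement_def
  proof (rule runs_SeqI[OF runs_copy_row[OF glob denotes_row_Top denotes_row_Num _ \<sigma> row]])
    fix \<rho>' A' assume "agree_below r_index \<rho>' \<rho> \<and> agree_except (\<rho> r_height + 2) A' A \<and>
      stored A' (\<rho> r_height + 2) \<sigma>"
    then show "runs (Assign r_ok (Num 1) ;; Assign r_code (Reg r_entry) ;;
        For r_index r_arity (write_digit q)) \<rho>' A' ?Q"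
      using e(2) l \<open>e < W\<close>
      by (intro runs_Seq runs_Assign digits)
        (simp_all add: Inv_def digits_written_def last_vars_def compatible_def refine_def)
  qed (use l rows_pos in auto)
qed

definition scanned :: "node \<Rightarrow> nat set \<Rightarrow> nat \<Rightarrow> (nat \<Rightarrow> nat option) list" where
  "scanned \<sigma> C e = filter (compatible \<sigma> C) (take e (assignments q (scope C)))"

lemma scanned_0 [simp]: "scanned \<sigma> C 0 = []"
  by (simp add: scanned_def)

lemma scanned_Suc:
  "e < table_size C \<Longrightarrow>
     scanned \<sigma> C (Suc e) = scanned \<sigma> C e @ (if compatible \<sigma> C (entry C e) then [entry C e] else [])"
  by (simp add: scanned_def take_Suc_conv_app_nth length_assignments table_size_def entry_def)

lemma scanned_table_size: "scanned \<sigma> C (table_size C) = entries \<sigma> C"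
  by (simp add: scanned_def entries_def length_assignments table_size_def)

lemma entry_not_in_scanned: "e < table_size C \<Longrightarrow> entry C e \<notin> set (scanned \<sigma> C e)"
  using distinct_assignments[OF distinct_scope, of q C]
  by (auto simp: scanned_def entry_def in_set_conv_nth nth_eq_iff_index_eq length_assignments
      table_size_def)

lemma length_scanned_le: "length (scanned \<sigma> C e) \<le> e"
  using length_filter_le[of "compatible \<sigma> C" "take e (assignments q (scope C))"]
  by (simp add: scanned_def)

definition scan_state :: "node \<Rightarrow> nat set \<Rightarrow> nat \<Rightarrow> nat \<Rightarrow> registers \<Rightarrow> matrix \<Rightarrow> bool" where
  "scan_state \<sigma> C h e \<rho> A \<longleftrightarrow>
     \<rho> r_first = (if scanned \<sigma> C e = [] then 0 else Suc (Cost I C (hd (scanned \<sigma> C e)))) \<and>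
     \<rho> r_found = of_bool (first_deviation (Cost I C) (scanned \<sigma> C e) \<noteq> None) \<and>
     \<rho> r_height = h + length (drop_deviation (Cost I C) (scanned \<sigma> C e)) \<and>
     stored_from A (h + 2) (map (refine \<sigma> C) (drop_deviation (Cost I C) (scanned \<sigma> C e)))"

lemma scan_state_height:
  assumes "scan_state \<sigma> C h e \<rho> A" "C \<in># Constraints I" "e < table_size C"
  shows "h \<le> \<rho> r_height" "\<rho> r_height \<le> h + table_bound"
  using length_drop_deviation_le[of "Cost I C" "scanned \<sigma> C e"] length_scanned_le[of \<sigma> C e]
    table_size_le[OF assms(2)] assms(1,3)
  by (auto simp: scan_state_def)

lemma scan_state_cong:
  assumes "scan_state \<sigma> C h e \<rho> A"
    and "\<And>y. y < r_entry \<Longrightarrow> \<rho>' y = \<rho> y" "\<And>l. l < \<rho> r_height + 2 \<Longrightarrow> A' l = A l"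
  shows "scan_state \<sigma> C h e \<rho>' A'"
proof -
  let ?kept = "map (refine \<sigma> C) (drop_deviation (Cost I C) (scanned \<sigma> C e))"
  have "stored_from A' (h + 2) ?kept \<longleftrightarrow> stored_from A (h + 2) ?kept"
    using assms(1,3) by (intro stored_from_cong) (auto simp: scan_state_def)
  then show ?thesis using assms(1,2) by (simp add: scan_state_def)
qed

lemma scan_state_Suc:
  assumes e: "e < table_size C" and inv: "scan_state \<sigma> C h e \<rho> A"
    and row: "stored A (\<rho> r_height + 2) (refine \<sigma> C (entry C e))"
    and found: "\<rho>' r_found = (if compatible \<sigma> C (entry C e) \<and>
      \<rho> r_first \<noteq> 0 \<and> \<rho> r_found = 0 \<and> Suc (Cost I C (entry C e)) \<noteq> \<rho> r_first then 1 else \<rho> r_found)"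
    and height: "\<rho>' r_height = (if compatible \<sigma> C (entry C e) \<and> \<not> (\<rho> r_first \<noteq> 0 \<and> \<rho> r_found = 0 \<and>
      Suc (Cost I C (entry C e)) \<noteq> \<rho> r_first) then Suc (\<rho> r_height) else \<rho> r_height)"
    and first: "\<rho>' r_first = (if compatible \<sigma> C (entry C e) \<and> \<rho> r_first = 0
      then Suc (Cost I C (entry C e)) else \<rho> r_first)"
  shows "scan_state \<sigma> C h (Suc e) \<rho>' A"
proof (cases "compatible \<sigma> C (entry C e)")
  case True
  then have scanned: "scanned \<sigma> C (Suc e) = scanned \<sigma> C e @ [entry C e]"
    using scanned_Suc[OF e] by simp
  show ?thesis
    using True inv row found height first unfolding scan_state_def scanned
    by (auto simp: first_deviation_snoc drop_deviation_snoc entry_not_in_scanned[OF e]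
        stored_from_snoc add.commute add.left_commute split: option.splits if_splits)
next
  case False
  then show ?thesis
    using inv found height first scanned_Suc[OF e] by (simp add: scan_state_def)
qed

lemma Cost_le:
  assumes "C \<in># Constraints I" "f \<in> wfuns q C"
  shows "Cost I C f \<le> M"
proof (rule input_le)
  have "f \<in> set (assignments q (scope C))" using assms by (simp add: set_assignments set_scope)
  then show "Cost I C f \<in> set (encode q I vs cs)"
    using assms(1) set_cs by (auto simp: encode_def encode_constraint_scope)
qed

lemma count_le: "C \<in># Constraints I \<Longrightarrow> count (Constraints I) C \<le> M"
  by (rule input_le) (auto simp: encode_def encode_constraint_scope simp flip: set_cs)

lemma hd_scanned_le:
  assumes "C \<in># Constraints I" "scanned \<sigma> C e \<noteq> []"
  shows "Cost I C (hd (scanned \<sigma> C e)) \<le> M"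
proof (rule Cost_le[OF assms(1)])
  have "hd (scanned \<sigma> C e) \<in> set (assignments q (scope C))"
    using hd_in_set[OF assms(2)] by (auto simp: scanned_def dest: in_set_takeD)
  then show "hd (scanned \<sigma> C e) \<in> wfuns q C" using assms(1) by (simp add: set_assignments set_scope)
qed

lemma runs_push_compatible:
  assumes j: "j < length cs" and e: "e < table_size (cs ! j)" "\<rho> r_entry = e"
    and h: "h + table_bound + 2 < rows" and ctx: "at_constraint \<sigma> j \<rho> A"
    and ok: "\<rho> r_ok = of_bool (compatible \<sigma> (cs ! j) (entry (cs ! j) e))"
    and row: "stored A (\<rho> r_height + 2) (refine \<sigma> (cs ! j) (entry (cs ! j) e))"
    and inv: "scan_state \<sigma> (cs ! j) h e \<rho> A"
  shows "runs push_compatible \<rho> A (\<lambda>\<rho>' A'. A' = A \<and> agree_below r_height \<rho>' \<rho> \<and> \<rho>' r_entry = e \<and>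
    scan_state \<sigma> (cs ! j) h (Suc e) \<rho>' A)"
proof -
  let ?C = "cs ! j"
  have C: "?C \<in># Constraints I" using nth_cs_constraint[OF j] .
  have pos: "\<rho> r_position = offset j" "\<rho> r_arity = length (scope ?C)"
    using ctx by (simp_all add: at_constraint_def)
  have "offset j + (2 + length (scope ?C) + e) < length input"
    using offset_add_less[OF j, of "2 + length (scope ?C) + e"] e(1) by simp
  then have cost: "layout A (offset j + (2 + length (scope ?C) + e)) = Cost I ?C (entry ?C e)"
      "offset j + (2 + length (scope ?C) + e) < W"
    using layout_input nth_input_cost[OF j e(1)] length_input_le base_less_word by auto
  have cost_less: "Suc (Cost I ?C (entry ?C e)) < W"
    using Cost_le[OF C entry_wfuns[OF C e(1)]] input_less_word by simp
  have "\<rho> r_first \<le> M + 1" using inv hd_scanned_le[OF C, of \<sigma> e] by (simp add: scan_state_def)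
  then have first_less: "\<rho> r_first < W" using input_less_word by linarith
  have found: "\<rho> r_found < W" using inv by (simp add: scan_state_def)
  have height: "Suc (\<rho> r_height) < W"
    using scan_state_height(2)[OF inv C e(1)] h rows_less_word by linarith
  note next_entry = scan_state_Suc[OF e(1) inv row]
  show ?thesis
    unfolding push_compatible_def
    using pos e(2) cost cost_less first_less found height ok
    by (intro runs_Seq runs_Assign runs_Cond runs_Skip) (simp_all add: next_entry)
qed

lemma entries_not_Nil:
  assumes "C \<in># Constraints I" "\<sigma> \<in> nodes"
  shows "entries \<sigma> C \<noteq> []"
  using length_entries[OF assms] by auto

lemma base_cost_le:
  assumes "C \<in># Constraints I" "\<sigma> \<in> nodes"
  shows "base_cost \<sigma> C \<le> M"
  using hd_in_set[OF entries_not_Nil[OF assms]] set_entries[OF assms(1)] Cost_le[OF assms(1)]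
  by (simp add: base_cost_def)

lemma weighted_base_cost_le:
  assumes "C \<in># Constraints I" "\<sigma> \<in> nodes"
  shows "count (Constraints I) C * base_cost \<sigma> C \<le> M * M"
  using count_le[OF assms(1)] base_cost_le[OF assms] by (rule mult_le_mono)

lemma runs_scan_entry:
  assumes \<sigma>: "\<sigma> \<in> nodes" and j: "j < length cs" and e: "e < table_size (cs ! j)" "\<rho> r_entry = e"
    and h: "h + table_bound + 2 < rows" and ctx: "at_constraint \<sigma> j \<rho> A"
    and inv: "scan_state \<sigma> (cs ! j) h e \<rho> A"
  shows "runs (scan_entry q) \<rho> A (\<lambda>\<rho>' A'. agree_below r_height \<rho>' \<rho> \<and> \<rho>' r_entry = e \<and>
    agree_below (h + 2) A' A \<and> scan_state \<sigma> (cs ! j) h (Suc e) \<rho>' A')" (is "runs _ _ _ ?Q")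
proof -
  let ?C = "cs ! j"
  note height = scan_state_height[OF inv nth_cs_constraint[OF j] e(1)]
  have row: "\<rho> r_height + 2 < rows" using height(2) h by simp
  show ?thesis
    unfolding scan_entry_def
  proof (rule runs_SeqI[OF runs_write_refinement[OF \<sigma> j e refl row ctx]])
    fix \<rho>1 A1
    assume refined: "agree_below r_ok \<rho>1 \<rho> \<and> agree_except (\<rho> r_height + 2) A1 A \<and>
      \<rho>1 r_ok = of_bool (compatible \<sigma> ?C (entry ?C e)) \<and>
      stored A1 (\<rho> r_height + 2) (refine \<sigma> ?C (entry ?C e))"
    have "scan_state \<sigma> ?C h e \<rho>1 A1" by (rule scan_state_cong[OF inv]) (use refined in simp_all)
    moreover have "at_constraint \<sigma> j \<rho>1 A1" using at_constraint_cong[OF ctx] refined by simp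
    ultimately show "runs push_compatible \<rho>1 A1 ?Q"
      using refined e height(1)
      by (intro runs_mono[OF runs_push_compatible[OF j e(1) _ h]]) auto
  qed
qed

lemma runs_scan_table:
  assumes \<sigma>: "\<sigma> \<in> nodes" and j: "j < length cs" and size: "\<rho> r_size = table_size (cs ! j)"
    and h: "h + table_bound + 2 < rows" and ctx: "at_constraint \<sigma> j \<rho> A"
    and init: "\<rho> r_height = h" "\<rho> r_first = 0" "\<rho> r_found = 0"
  shows "runs (scan_table q) \<rho> A (\<lambda>\<rho>' A'.
    agree_below r_height \<rho>' \<rho> \<and> agree_below (h + 2) A' A \<and>
    scan_state \<sigma> (cs ! j) h (table_size (cs ! j)) \<rho>' A')"
proof -
  let ?C = "cs ! j"
  define Inv where "Inv e \<rho>' A' \<longleftrightarrow> agree_below r_height \<rho>' \<rho> \<and> agree_below (h + 2) A' A \<and>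
    scan_state \<sigma> ?C h e \<rho>' A'" for e \<rho>' A'
  have bound: "table_size ?C \<le> table_bound" using table_size_le[OF nth_cs_constraint[OF j]] .
  show ?thesis
    unfolding scan_table_def
  proof (rule runs_For[where Inv = Inv and k = "table_size ?C"])
    fix e \<rho>' A' assume e: "e < table_size ?C" "\<rho>' r_entry = e" and inv: "Inv e \<rho>' A'"
    have ctx': "at_constraint \<sigma> j \<rho>' A'" using at_constraint_cong[OF ctx] inv by (simp add: Inv_def)
    show "runs (scan_entry q) \<rho>' A'
        (\<lambda>\<rho>' A'. \<rho>' r_entry = e \<and> Inv (Suc e) (\<rho>'(r_entry := Suc e)) A')"
      by (rule runs_mono[OF runs_scan_entry[OF \<sigma> j e h ctx']])
        (use inv in \<open>auto simp: Inv_def scan_state_def\<close>)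
  next
    show "table_size ?C \<le> max_trips" using bound by (simp add: max_trips_def)
    show "table_size ?C < W" using bound table_less_word by linarith
  qed (use init size in \<open>auto simp: Inv_def scan_state_def\<close>)
qed

lemma runs_load_constraint:
  assumes j: "j < length cs" and pos: "\<rho> r_position = offset j" and h: "\<rho> r_height < W"
  shows "runs (load_constraint q) \<rho> A (\<lambda>\<rho>' A'. A' = A \<and> agree_below r_arity \<rho>' \<rho> \<and>
    \<rho>' r_arity = length (scope (cs ! j)) \<and> \<rho>' r_size = table_size (cs ! j) \<and>
    \<rho>' r_bottom = \<rho> r_height \<and> \<rho>' r_height = \<rho> r_height \<and> \<rho>' r_found = \<rho> r_found \<and> \<rho>' r_first = 0)"
    (is "runs _ _ _ ?Q")
proof -
  let ?len = "length (scope (cs ! j))"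
  have C: "cs ! j \<in># Constraints I" using nth_cs_constraint[OF j] .
  define Inv where "Inv t \<rho>' A' \<longleftrightarrow> A' = A \<and> agree_below r_arity \<rho>' \<rho> \<and> \<rho>' r_arity = ?len \<and>
    \<rho>' r_size = (q + 1) ^ t \<and> \<rho>' r_height = \<rho> r_height \<and> \<rho>' r_found = \<rho> r_found"
    for t :: nat and \<rho>' A'
  have size: "runs (For r_index r_arity (multiply_size q)) \<rho>1 A1 (Inv ?len)"
    if init: "Inv 0 (\<rho>1(r_index := 0)) A1" for \<rho>1 A1
  proof (rule runs_For[where Inv = Inv and k = ?len])
    fix t \<rho>' A' assume t: "t < ?len" "\<rho>' r_index = t" and inv: "Inv t \<rho>' A'"
    have "(q + 1) ^ t \<le> (q + 1) ^ Suc t" "(q + 1) ^ Suc t \<le> table_bound"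
      using t(1) length_scope_le[OF C] unfolding table_bound_def by (intro power_increasing; simp)+
    then have "(q + 1) ^ t < W" "(q + 1) ^ t * (q + 1) < W"
      using table_less_word by (simp_all add: mult.commute)
    then show "runs (multiply_size q) \<rho>' A'
        (\<lambda>\<rho>' A'. \<rho>' r_index = t \<and> Inv (Suc t) (\<rho>'(r_index := Suc t)) A')"
      unfolding multiply_size_def using t inv
      by (intro runs_Assign) (auto simp: Inv_def mult.commute)
  qed (use init length_scope_trips[OF C] in \<open>auto simp: Inv_def\<close>)
  have "offset j < length input" using offset_add_less[OF j, of 0] by simp
  then have arity: "layout A (offset j) = ?len" "offset j < W"
    using layout_input nth_input_arity[OF j] length_input_le base_less_word by auto
  show ?thesis
    unfolding load_constraint_def
    using pos h arity length_scope_trips(2)[OF C]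
    by (intro runs_Seq runs_Assign runs_SeqI[OF size]) (auto simp: Inv_def table_size_def)
qed

lemma runs_skip_constraint:
  assumes \<sigma>: "\<sigma> \<in> nodes" and j: "j < length cs" and ctx: "at_constraint \<sigma> j \<rho> A"
    and size: "\<rho> r_size = table_size (cs ! j)" and first: "\<rho> r_first = Suc (base_cost \<sigma> (cs ! j))"
    and less: "\<rho> r_bottom < W" "\<rho> r_total + M * M < W"
  shows "runs skip_constraint \<rho> A (\<lambda>\<rho>' A'. A' = A \<and> agree_below r_position \<rho>' \<rho> \<and>
    \<rho>' r_found = \<rho> r_found \<and> \<rho>' r_height = \<rho> r_bottom \<and> \<rho>' r_position = offset (Suc j) \<and>
    \<rho>' r_total = \<rho> r_total + count (Constraints I) (cs ! j) * base_cost \<sigma> (cs ! j))"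
proof -
  let ?C = "cs ! j"
  have C: "?C \<in># Constraints I" using nth_cs_constraint[OF j] .
  have pos: "\<rho> r_position = offset j" "\<rho> r_arity = length (scope ?C)"
    using ctx by (simp_all add: at_constraint_def)
  have "offset j + 1 < length input" using offset_add_less[OF j, of 1] by simp
  then have count: "layout A (Suc (offset j)) = count (Constraints I) ?C" "Suc (offset j) < W"
    using layout_input[of "offset j + 1" A] nth_input_count[OF j] length_input_le base_less_word
    by auto
  have "offset (Suc j) \<le> length input"
    using offset_mono[of "Suc j" "length cs"] j by (simp add: length_input)
  then have "offset (Suc j) < W" using length_input_le base_less_word by linarith
  then have "offset j + 2 + (length (scope ?C) + table_size ?C) < W" by (simp add: offset_Suc)
  moreover have "Suc (base_cost \<sigma> ?C) < W" "count (Constraints I) ?C < W"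
    using base_cost_le[OF C \<sigma>] count_le[OF C] input_less_word by linarith+
  moreover have "count (Constraints I) ?C * base_cost \<sigma> ?C < W"
      "\<rho> r_total + count (Constraints I) ?C * base_cost \<sigma> ?C < W" "\<rho> r_total < W"
    using weighted_base_cost_le[OF C \<sigma>] less(2) by linarith+
  ultimately show ?thesis
    unfolding skip_constraint_def
    using pos count size first less(1)
    by (intro runs_Seq runs_Assign) (auto simp: offset_Suc)
qed

definition scan_result :: "node \<Rightarrow> nat \<Rightarrow> nat set list \<Rightarrow> registers \<Rightarrow> matrix \<Rightarrow> bool" where
  "scan_result \<sigma> h Cs \<rho> A \<longleftrightarrow> (case branching_constraint \<sigma> Cs of
     None \<Rightarrow> \<rho> r_found = 0 \<and> \<rho> r_height = h \<and> \<rho> r_position = offset (length Cs) \<and>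
       \<rho> r_total = (\<Sum>C\<leftarrow>Cs. count (Constraints I) C * base_cost \<sigma> C)
   | Some C \<Rightarrow> \<rho> r_found = 1 \<and> \<rho> r_height = h + length (children \<sigma> C) \<and>
       stored_from A (h + 2) (children \<sigma> C))"

lemma sum_base_cost_le:
  assumes "set Cs \<subseteq> set cs" "\<sigma> \<in> nodes"
  shows "(\<Sum>C\<leftarrow>Cs. count (Constraints I) C * base_cost \<sigma> C) \<le> length Cs * (M * M)"
proof -
  have "(\<Sum>C\<leftarrow>Cs. count (Constraints I) C * base_cost \<sigma> C) \<le> (\<Sum>C\<leftarrow>Cs. M * M)"
    using assms weighted_base_cost_le by (intro sum_list_mono) (auto simp: set_cs)
  then show ?thesis by (simp add: sum_list_triv)
qed

lemma scan_resultD: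
  assumes "scan_result \<sigma> h (take j cs) \<rho> A" "\<rho> r_found = 0" "j \<le> length cs"
  shows "branching_constraint \<sigma> (take j cs) = None" "\<rho> r_height = h" "\<rho> r_position = offset j"
    and "\<rho> r_total = (\<Sum>C\<leftarrow>take j cs. count (Constraints I) C * base_cost \<sigma> C)"
  using assms by (auto simp: scan_result_def split: option.splits)

lemma scanned_total_less:
  assumes "\<sigma> \<in> nodes" "j < length cs"
  shows "(\<Sum>C\<leftarrow>take j cs. count (Constraints I) C * base_cost \<sigma> C) + M * M < W"
proof -
  have "(\<Sum>C\<leftarrow>take j cs. count (Constraints I) C * base_cost \<sigma> C) + M * M \<le> Suc j * (M * M)"
    using sum_base_cost_le[of "take j cs", OF set_take_subset assms(1)] assms(2) by simp
  also have "\<dots> \<le> length cs * (M * M)" using assms(2) by (intro mult_le_mono1) simp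
  finally show ?thesis using cost_less by linarith
qed

lemma runs_finish_constraint:
  assumes \<sigma>: "\<sigma> \<in> nodes" and j: "j < length cs" and ctx: "at_constraint \<sigma> j \<rho> A"
    and size: "\<rho> r_size = table_size (cs ! j)" and h: "\<rho> r_bottom = h" "h < W"
    and scan: "scan_state \<sigma> (cs ! j) h (table_size (cs ! j)) \<rho> A"
    and uniform: "branching_constraint \<sigma> (take j cs) = None"
    and total: "\<rho> r_total = (\<Sum>C\<leftarrow>take j cs. count (Constraints I) C * base_cost \<sigma> C)"
  shows "runs finish_constraint \<rho> A (\<lambda>\<rho>' A'. A' = A \<and>
    agree_below r_position \<rho>' \<rho> \<and> scan_result \<sigma> h (take (Suc j) cs) \<rho>' A')" (is "runs _ _ _ ?Q")
  unfolding finish_constraint_def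
proof (rule runs_Cond)
  let ?C = "cs ! j"
  note scan = scan[unfolded scan_state_def scanned_table_size]
  have C: "?C \<in># Constraints I" using nth_cs_constraint[OF j] .
  have branch: "branching_constraint \<sigma> (take (Suc j) cs) =
      (if deviation \<sigma> ?C = None then None else Some ?C)"
    using j uniform by (simp add: branching_constraint_def take_Suc_conv_app_nth find_append)
  show "fits W (machine \<rho> A) (Reg r_found)" using scan by simp
  show "runs Skip \<rho> A ?Q" if "val (machine \<rho> A) (Reg r_found) \<noteq> 0"
    using that scan branch by (intro runs_Skip) (auto simp: scan_result_def children_def)
  show "runs skip_constraint \<rho> A ?Q" if "val (machine \<rho> A) (Reg r_found) = 0"
  proof (rule runs_mono[OF runs_skip_constraint[OF \<sigma> j ctx size]])
    show "\<rho> r_first = Suc (base_cost \<sigma> ?C)"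
      using scan entries_not_Nil[OF C \<sigma>] by (simp add: base_cost_def)
    show "\<rho> r_bottom < W" "\<rho> r_total + M * M < W"
      using h total scanned_total_less[OF \<sigma> j] by simp_all
    fix \<rho>' A'
    assume "A' = A \<and> agree_below r_position \<rho>' \<rho> \<and> \<rho>' r_found = \<rho> r_found \<and>
      \<rho>' r_height = \<rho> r_bottom \<and> \<rho>' r_position = offset (Suc j) \<and>
      \<rho>' r_total = \<rho> r_total + count (Constraints I) ?C * base_cost \<sigma> ?C"
    then show "?Q \<rho>' A'"
      using that scan branch h total j by (simp add: scan_result_def take_Suc_conv_app_nth)
  qed
qed

lemma runs_scan_constraint:
  assumes \<sigma>: "\<sigma> \<in> nodes" and j: "j < length cs" and glob: "globals \<rho>" and row: "stored A 0 \<sigma>"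
    and h: "h + table_bound + 2 < rows"
    and inv: "scan_result \<sigma> h (take j cs) \<rho> A" and found: "\<rho> r_found = 0"
  shows "runs (scan_constraint q) \<rho> A (\<lambda>\<rho>' A'.
    agree_below r_position \<rho>' \<rho> \<and> agree_below (h + 2) A' A \<and>
    scan_result \<sigma> h (take (Suc j) cs) \<rho>' A')" (is "runs _ _ _ ?Q")
proof -
  let ?C = "cs ! j"
  note before = scan_resultD[OF inv found less_imp_le[OF j]]
  have "h < W" using h rows_less_word by simp
  show ?thesis
    unfolding scan_constraint_def
  proof (rule runs_SeqI[OF runs_load_constraint[where \<rho> = \<rho>, OF j before(3)]])
    show "\<rho> r_height < W" using before(2) \<open>h < W\<close> by simp
    fix \<rho>1 A1
    assume loaded: "A1 = A \<and> agree_below r_arity \<rho>1 \<rho> \<and>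
      \<rho>1 r_arity = length (scope ?C) \<and> \<rho>1 r_size = table_size ?C \<and>
      \<rho>1 r_bottom = \<rho> r_height \<and> \<rho>1 r_height = \<rho> r_height \<and> \<rho>1 r_found = \<rho> r_found \<and> \<rho>1 r_first = 0"
    have ctx: "at_constraint \<sigma> j \<rho>1 A1"
      using loaded glob row before(3) by (simp add: at_constraint_def globals_def)
    show "runs (scan_table q ;; finish_constraint) \<rho>1 A1 ?Q"
    proof (rule runs_SeqI[OF runs_scan_table[OF \<sigma> j _ h ctx]])
      fix \<rho>2 A2
      assume scan: "agree_below r_height \<rho>2 \<rho>1 \<and> agree_below (h + 2) A2 A1 \<and>
        scan_state \<sigma> ?C h (table_size ?C) \<rho>2 A2"
      then have "at_constraint \<sigma> j \<rho>2 A2" using at_constraint_cong[OF ctx] by simp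
      from runs_finish_constraint[OF \<sigma> j this _ _ \<open>h < W\<close> _ before(1)]
      show "runs finish_constraint \<rho>2 A2 ?Q"
        by (rule runs_mono) (use scan loaded before in auto)
    qed (use loaded found before in auto)
  qed
qed

lemma runs_scan_constraints:
  assumes \<sigma>: "\<sigma> \<in> nodes" and glob: "globals \<rho>" and row: "stored A 0 \<sigma>"
    and h: "h + table_bound + 2 < rows" and init: "scan_result \<sigma> h [] \<rho> A"
  shows "runs (scan_constraints q) \<rho> A
    (\<lambda>\<rho>' A'. agree_below r_constraint \<rho>' \<rho> \<and> agree_below (h + 2) A' A \<and> scan_result \<sigma> h cs \<rho>' A')"
proof -
  define Inv where "Inv j \<rho>' A' \<longleftrightarrow> agree_below r_constraint \<rho>' \<rho> \<and> agree_below (h + 2) A' A \<and>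
    scan_result \<sigma> h (take j cs) \<rho>' A'" for j \<rho>' A'
  show ?thesis
    unfolding scan_constraints_def
  proof (rule runs_For[where Inv = Inv and k = "length cs"])
    fix j \<rho>' A' assume j: "j < length cs" "\<rho>' r_constraint = j" and inv: "Inv j \<rho>' A'"
    let ?Q = "\<lambda>\<rho>' A'. \<rho>' r_constraint = j \<and> Inv (Suc j) (\<rho>'(r_constraint := Suc j)) A'"
    show "runs (Cond (Reg r_found) Skip (scan_constraint q)) \<rho>' A' ?Q"
    proof (rule runs_Cond)
      show "fits W (machine \<rho>' A') (Reg r_found)"
        using inv by (auto simp: Inv_def scan_result_def split: option.splits)
      show "runs Skip \<rho>' A' ?Q" if "val (machine \<rho>' A') (Reg r_found) \<noteq> 0"
        using that inv j
        by (intro runs_Skip)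
          (auto simp: Inv_def scan_result_def branching_constraint_def find_append
            take_Suc_conv_app_nth split: option.splits)
      show "runs (scan_constraint q) \<rho>' A' ?Q" if "val (machine \<rho>' A') (Reg r_found) = 0"
      proof (rule runs_mono[OF runs_scan_constraint[OF \<sigma> j(1) _ _ h]])
        show "globals \<rho>'" using globals_cong[OF glob] inv by (simp add: Inv_def)
        show "stored A' 0 \<sigma>" using row inv by (simp add: Inv_def stored_def)
      qed (use that inv j in \<open>auto simp: Inv_def scan_result_def split: option.splits\<close>)
    qed
  qed (use init glob in \<open>auto simp: Inv_def globals_def max_trips_def scan_result_def
        split: option.splits\<close>)
qed

lemma runs_pop_node:
  assumes \<sigma>: "\<sigma> \<in> nodes" "stored A (h + 2) \<sigma>" and glob: "globals \<rho>"
    and h: "\<rho> r_height = Suc h" "h + 2 < rows"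
  shows "runs pop_node \<rho> A (\<lambda>\<rho>' A'. agree_below r_constraint \<rho>' \<rho> \<and> agree_except 0 A' A \<and>
    stored A' 0 \<sigma> \<and> scan_result \<sigma> h [] \<rho>' A')" (is "runs _ _ _ ?Q")
proof -
  let ?\<rho> = "\<rho>(r_height := h)"
  let ?init = "Assign r_total (Num 0) ;; Assign r_found (Num 0) ;;
    Assign r_position (Op Plus (Num 2) (Reg r_vars))"
  have "2 + length vs < W" using base_less_word by (simp add: base_def)
  moreover have "denotes_row ?\<rho> Top (h + 2)" using denotes_row_Top[of ?\<rho>] h by simp
  ultimately have "runs (copy_row (Num 0) Top ;; ?init) ?\<rho> A ?Q"
    using \<sigma> h rows_pos glob
    by (intro runs_SeqI[OF runs_copy_row[where k = 0 and l = "h + 2"]] runs_Seq runs_Assign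
        denotes_row_Num)
      (auto simp: scan_result_def branching_constraint_def offset_def globals_def)
  then show ?thesis
    unfolding pop_node_def using h rows_less_word by (intro runs_Seq[OF runs_Assign]) auto
qed

lemma runs_count_wildcards:
  assumes \<sigma>: "\<sigma> \<in> nodes" "stored A 0 \<sigma>" and glob: "globals \<rho>" and less: "\<rho> r_total + length vs < W"
  shows "runs count_wildcards \<rho> A (\<lambda>\<rho>' A'. A' = A \<and> (\<forall>y<r_index. y \<noteq> r_total \<longrightarrow> \<rho>' y = \<rho> y) \<and>
    \<rho>' r_total = \<rho> r_total + wnorm (Vars I) (completion \<sigma>))"
proof -
  define found where "found i = length (filter (\<lambda>v. \<sigma> v = Some None) (take i vs))" for i
  define Inv where "Inv i \<rho>' A' \<longleftrightarrow> A' = A \<and> (\<forall>y<r_index. y \<noteq> r_total \<longrightarrow> \<rho>' y = \<rho> y) \<and>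
    \<rho>' r_total = \<rho> r_total + found i" for i \<rho>' A'
  have "found (length vs) = wnorm (Vars I) (completion \<sigma>)"
    using distinct_length_filter[OF distinct_vs, of "\<lambda>v. \<sigma> v = Some None"]
    by (simp add: found_def wnorm_completion set_vs Int_def conj_commute)
  moreover have "runs count_wildcards \<rho> A (Inv (length vs))"
    unfolding count_wildcards_def
  proof (rule runs_For[where Inv = Inv and k = "length vs"])
    fix i \<rho>' A' assume i: "i < length vs" "\<rho>' r_index = i" and inv: "Inv i \<rho>' A'"
    have v: "vs ! i \<in> Vars I" "vs ! i \<le> M" using nth_vs[OF i(1)] Vars_le by auto
    have glob': "globals \<rho>'" using globals_cong[OF glob] inv by (simp add: Inv_def)
    have "found i \<le> i" using length_filter_le[of _ "take i vs"] i by (simp add: found_def le_trans)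
    then have total: "Suc (\<rho>' r_total) < W" using inv less i by (simp add: Inv_def)
    have cell: "A' 0 (vs ! i) = node_code (\<sigma> (vs ! i))"
      using inv \<sigma>(2) v(1) by (simp add: Inv_def stored_def)
    have "node_code (\<sigma> (vs ! i)) = 0 \<longleftrightarrow> \<sigma> (vs ! i) = Some None"
      using node_code_eq_iff(2)[OF \<sigma>(1), of None "vs ! i"] by (simp add: wvalues_def)
    then show "runs count_wildcard \<rho>' A'
        (\<lambda>\<rho>' A'. \<rho>' r_index = i \<and> Inv (Suc i) (\<rho>'(r_index := Suc i)) A')"
      unfolding count_wildcard_def
      using i v glob' total cell inv node_code_less[OF \<sigma>(1)] rows_pos
      by (intro runs_Cond runs_Skip runs_Assign)
        (auto simp: Inv_def found_def take_Suc_conv_app_nth)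
  qed (use glob in \<open>auto simp: Inv_def found_def globals_def max_trips_def\<close>)
  ultimately show ?thesis by (auto simp: Inv_def elim!: runs_mono)
qed

lemma total_cost_le:
  assumes "\<phi> \<in> wfuns q (Vars I)"
  shows "total_cost I \<phi> \<le> length cs * (M * M) + length vs"
proof -
  have "count (Constraints I) C * Cost I C (restrict \<phi> C) \<le> M * M" if "C \<in> set cs" for C
    using that restrict_wfuns[OF assms constraint_subset]
    by (intro mult_le_mono count_le Cost_le) (auto simp: set_cs)
  then have "(\<Sum>C\<leftarrow>cs. count (Constraints I) C * Cost I C (restrict \<phi> C)) \<le> (\<Sum>C\<leftarrow>cs. M * M)"
    by (intro sum_list_mono)
  then have "(\<Sum>C\<leftarrow>cs. count (Constraints I) C * Cost I C (restrict \<phi> C)) \<le> length cs * (M * M)"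
    by (simp add: sum_list_triv)
  moreover have "wnorm (Vars I) \<phi> \<le> length vs"
    unfolding wnorm_def length_vs by (intro card_mono) auto
  ultimately show ?thesis unfolding total_cost_sum_list by (metis add.commute add_mono order_refl)
qed

definition best_code :: "node option \<Rightarrow> nat" where
  "best_code best = (case best of None \<Rightarrow> 0 | Some \<beta> \<Rightarrow> Suc (total_cost I (completion \<beta>)))"

lemma best_code_less:
  assumes "set_option best \<subseteq> nodes"
  shows "best_code best < W"
proof (cases best)
  case (Some \<beta>)
  then have "total_cost I (completion \<beta>) \<le> length cs * (M * M) + length vs"
    using assms by (intro total_cost_le completion_wfuns) simp
  then show ?thesis using Some cost_less by (simp add: best_code_def)
qed (simp add: best_code_def)

definition best_stored :: "node option \<Rightarrow> registers \<Rightarrow> matrix \<Rightarrow> bool" where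
  "best_stored best \<rho> A \<longleftrightarrow> \<rho> r_best = best_code best \<and> (\<forall>\<beta>. best = Some \<beta> \<longrightarrow> stored A 1 \<beta>)"

lemma runs_update_best:
  assumes \<sigma>: "\<sigma> \<in> nodes" "stored A 0 \<sigma>" and glob: "globals \<rho>" and best: "set_option best \<subseteq> nodes"
    and total: "\<rho> r_total = total_cost I (completion \<sigma>)" and inv: "best_stored best \<rho> A"
  shows "runs update_best \<rho> A (\<lambda>\<rho>' A'. (\<forall>y<r_index. y \<noteq> r_best \<longrightarrow> \<rho>' y = \<rho> y) \<and>
    agree_except 1 A' A \<and> best_stored (improve best \<sigma>) \<rho>' A')" (is "runs _ _ _ ?Q")
proof -
  let ?c = "total_cost I (completion \<sigma>)"
  have less: "Suc ?c < W" "\<rho> r_best < W"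
    using best_code_less[of "Some \<sigma>"] best_code_less[OF best] \<sigma> inv
    by (simp_all add: best_code_def best_stored_def)
  have improve: "improve best \<sigma> = (if \<rho> r_best = 0 \<or> Suc ?c < \<rho> r_best then Some \<sigma> else best)"
    using inv by (auto simp: best_stored_def best_code_def improve_def split: option.splits)
  have copy: "runs (copy_row (Num 1) (Num 0)) (\<rho>(r_cost := Suc ?c, r_best := Suc ?c)) A ?Q"
    if "improve best \<sigma> = Some \<sigma>"
    by (rule runs_mono[OF runs_copy_row[OF _ denotes_row_Num denotes_row_Num _ \<sigma>]])
      (use that glob in \<open>auto simp: rows_def best_stored_def best_code_def\<close>)
  show ?thesis
    unfolding update_best_def
    using total less inv copy improve
    by (intro runs_Seq runs_Assign runs_Cond runs_Skip) (auto simp: best_stored_def)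
qed

fun search_state :: "node list \<times> node option \<Rightarrow> registers \<Rightarrow> matrix \<Rightarrow> bool" where
  "search_state (stack, best) \<rho> A \<longleftrightarrow>
     globals \<rho> \<and> \<rho> r_height = length stack \<and> stored_from A 2 stack \<and> best_stored best \<rho> A"

lemma runs_evaluate_leaf:
  assumes \<sigma>: "\<sigma> \<in> nodes" "stored A 0 \<sigma>" and best: "set_option best \<subseteq> nodes"
    and leaf: "branching_constraint \<sigma> cs = None" and scan: "scan_result \<sigma> (length stack) cs \<rho> A"
    and glob: "globals \<rho>" and stack: "stored_from A 2 stack" and inv: "best_stored best \<rho> A"
  shows "runs (count_wildcards ;; update_best) \<rho> A (search_state (search_step \<sigma> (stack, best)))"
proof -
  have total: "\<rho> r_total + wnorm (Vars I) (completion \<sigma>) = total_cost I (completion \<sigma>)"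
    and height: "\<rho> r_height = length stack"
    using scan leaf total_cost_leaf[OF leaf completion_wfuns[OF \<sigma>(1)] compatible_completion]
    by (simp_all add: scan_result_def)
  have "\<rho> r_total \<le> length cs * (M * M)"
    using scan leaf sum_base_cost_le[of cs \<sigma>] \<sigma>(1) by (simp add: scan_result_def)
  then have "\<rho> r_total + length vs < W" using cost_less by linarith
  from runs_count_wildcards[OF \<sigma> glob this] show ?thesis
  proof (rule runs_SeqI)
    fix \<rho>1 A1
    assume counted: "A1 = A \<and> (\<forall>y<r_index. y \<noteq> r_total \<longrightarrow> \<rho>1 y = \<rho> y) \<and>
      \<rho>1 r_total = \<rho> r_total + wnorm (Vars I) (completion \<sigma>)"
    show "runs update_best \<rho>1 A1 (search_state (search_step \<sigma> (stack, best)))"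
    proof (rule runs_mono[OF runs_update_best[OF \<sigma>(1) _ _ best]])
      fix \<rho>2 A2
      assume updated: "(\<forall>y<r_index. y \<noteq> r_best \<longrightarrow> \<rho>2 y = \<rho>1 y) \<and> agree_except 1 A2 A1 \<and>
        best_stored (improve best \<sigma>) \<rho>2 A2"
      then have "stored_from A2 2 stack"
        using stack counted stored_from_cong[of 2 stack A2 A] by simp
      moreover have "globals \<rho>2" using globals_cong[OF glob, of \<rho>2] counted updated by simp
      ultimately show "search_state (search_step \<sigma> (stack, best)) \<rho>2 A2"
        using leaf counted updated height by simp
    qed (use counted total \<sigma>(2) inv globals_cong[OF glob, of \<rho>1] in \<open>auto simp: best_stored_def\<close>)
  qed
qed

lemma runs_finish_node:
  assumes \<sigma>: "\<sigma> \<in> nodes" "stored A 0 \<sigma>" and best: "set_option best \<subseteq> nodes"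
    and scan: "scan_result \<sigma> (length stack) cs \<rho> A"
    and glob: "globals \<rho>" and stack: "stored_from A 2 stack" and inv: "best_stored best \<rho> A"
  shows "runs finish_node \<rho> A
    (search_state (search_step \<sigma> (stack, best)))" (is "runs _ _ _ ?Q")
  unfolding finish_node_def
proof (rule runs_Cond)
  show "fits W (machine \<rho> A) (Reg r_found)"
    using scan by (auto simp: scan_result_def split: option.splits)
  show "runs Skip \<rho> A ?Q" if "val (machine \<rho> A) (Reg r_found) \<noteq> 0"
    using that scan glob stack inv
    by (intro runs_Skip)
      (auto simp: scan_result_def stored_from_append add.commute split: option.splits)
  show "runs (count_wildcards ;; update_best) \<rho> A ?Q" if "val (machine \<rho> A) (Reg r_found) = 0"
    using that scan
    by (intro runs_evaluate_leaf[OF \<sigma> best _ scan glob stack inv])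
      (auto simp: scan_result_def split: option.splits)
qed

lemma runs_process_node:
  assumes inv: "search_inv (stack @ [\<sigma>], best)" and bounded: "height_bounded (stack @ [\<sigma>])"
    and state: "search_state (stack @ [\<sigma>], best) \<rho> A"
  shows "runs (process_node q) \<rho> A (search_state (search_step \<sigma> (stack, best)))"
    (is "runs _ _ _ ?Q")
proof -
  define h where "h = length stack"
  have \<sigma>: "\<sigma> \<in> nodes" and best: "set_option best \<subseteq> nodes" using inv by auto
  have glob: "globals \<rho>" and height: "\<rho> r_height = Suc h" and stack: "stored_from A 2 stack"
    and row: "stored A (h + 2) \<sigma>" and best_row: "best_stored best \<rho> A"
    using state by (simp_all add: h_def stored_from_snoc add.commute)
  have "h \<le> length vs * table_bound"
    using height_boundedD[OF bounded] by (simp add: h_def table_bound_def)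
  then have h: "h + table_bound + 2 < rows" "h + 2 < rows" by (simp_all add: rows_def)
  show ?thesis
    unfolding process_node_def
  proof (rule runs_SeqI[OF runs_pop_node[OF \<sigma> row glob height h(2)]])
    fix \<rho>1 A1
    assume popped: "agree_below r_constraint \<rho>1 \<rho> \<and> agree_except 0 A1 A \<and> stored A1 0 \<sigma> \<and>
      scan_result \<sigma> h [] \<rho>1 A1"
    then have glob1: "globals \<rho>1" using globals_cong[OF glob] by simp
    show "runs (scan_constraints q ;; finish_node) \<rho>1 A1 ?Q"
    proof (rule runs_SeqI[OF runs_scan_constraints[OF \<sigma> glob1 _ h(1)]])
      fix \<rho>2 A2
      assume scan: "agree_below r_constraint \<rho>2 \<rho>1 \<and> agree_below (h + 2) A2 A1 \<and>
        scan_result \<sigma> h cs \<rho>2 A2"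
      show "runs finish_node \<rho>2 A2 ?Q"
      proof (rule runs_finish_node[OF \<sigma> _ best])
        show "stored_from A2 2 stack"
          using stack popped scan stored_from_cong[of 2 stack A2 A] by (simp add: h_def)
      qed (use popped scan best_row globals_cong[OF glob1, of \<rho>2]
            in \<open>auto simp: h_def stored_def best_stored_def\<close>)
    qed (use popped in auto)
  qed
qed

lemma initial_input: "initial input = machine (\<lambda>_. 0) (\<lambda>_ _. 0)"
  using length_input_le by (auto simp: initial_def machine_def layout_def)

lemma runs_mark_free:
  assumes glob: "globals \<rho>"
  shows "runs (mark_free q) \<rho> A (\<lambda>\<rho>' A'. agree_below r_index \<rho>' \<rho> \<and> stored A' 2 Map.empty)"
  unfolding mark_free_def
proof (rule runs_For[where k = "length vs" and
      Inv = "\<lambda>i \<rho>' A'. agree_below r_index \<rho>' \<rho> \<and> (\<forall>v\<in>set (take i vs). A' 2 v = q + 1)"])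
  fix i \<rho>' and A' :: matrix
  assume i: "i < length vs" "\<rho>' r_index = i"
    and inv: "agree_below r_index \<rho>' \<rho> \<and> (\<forall>v\<in>set (take i vs). A' 2 v = q + 1)"
  have "globals \<rho>'" using globals_cong[OF glob] inv by simp
  then show "runs (Store (Addr VarName (Num 2)) (Num (q + 1))) \<rho>' A' (\<lambda>\<rho>' A'. \<rho>' r_index = i \<and>
      agree_below r_index (\<rho>'(r_index := Suc i)) \<rho> \<and> (\<forall>v\<in>set (take (Suc i) vs). A' 2 v = q + 1))"
    using i inv Vars_le[OF nth_vs[OF i(1)]]
    by (intro runs_Store_Addr) (auto simp: take_Suc_conv_app_nth rows_def)
qed (use glob in \<open>auto simp: globals_def max_trips_def stored_def set_vs\<close>)

lemma runs_push_root: "runs (push_root q r) (\<lambda>_. 0) (\<lambda>_ _. 0) (search_state ([Map.empty], None))"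
proof -
  have "0 < length input" using one_less_length_input by linarith
  then have header: "layout A 0 = length vs" "layout A (Suc 0) = length cs" for A
    using layout_input[of _ A] one_less_length_input nth_input_vars nth_input_constraints
    by simp_all
  have less: "length vs * table_bound < W" "table_bound + 3 < W"
    "length vs * table_bound + (table_bound + 3) < W"
    "2 + length vs < W" "2 + r + table_bound < W" "length cs * (2 + r + table_bound) < W"
    "2 + length vs + length cs * (2 + r + table_bound) < W"
    using word_limits by (simp_all add: rows_def base_def)
  show ?thesis
    unfolding push_root_def table_bound_def[symmetric]
    using header less
    by (intro runs_Seq[OF runs_Assign] runs_SeqI[OF runs_mark_free] runs_Assign)
      (auto simp: globals_def rows_def base_def best_stored_def best_code_def add.assoc)
qed

definition loop_inv :: "node list \<times> node option \<Rightarrow> ram \<Rightarrow> bool" where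
  "loop_inv g s \<longleftrightarrow>
     (\<exists>\<rho> A. s = machine \<rho> A \<and> search_state g \<rho> A) \<and> search_inv g \<and> height_bounded (fst g)"

definition optimum_stored :: "ram \<Rightarrow> bool" where
  "optimum_stored s \<longleftrightarrow> (\<exists>\<rho> A \<beta>. s = machine \<rho> A \<and> globals \<rho> \<and>
     \<beta> \<in> nodes \<and> stored A 1 \<beta> \<and> optimal q I (completion \<beta>))"

lemma loop_inv_val_height: "loop_inv (stack, best) s \<Longrightarrow> val s (Reg r_height) = length stack"
  by (auto simp: loop_inv_def)

lemma loop_inv_fits_height:
  assumes "loop_inv (stack, best) s"
  shows "fits W s (Reg r_height)"
proof (cases stack rule: rev_cases)
  case (snoc below \<sigma>)
  then have "length below \<le> length vs * (q + 1) ^ r"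
    using assms height_boundedD by (auto simp: loop_inv_def)
  then have "length stack < rows" using snoc by (simp add: rows_def table_bound_def)
  then show ?thesis using loop_inv_val_height[OF assms] rows_less_word by simp
qed (use loop_inv_val_height[OF assms] in simp)

lemma wp_process_node:
  assumes "loop_inv (stack @ [\<sigma>], best) s"
  shows "wp W trips (process_node q) (loop_inv (search_step \<sigma> (stack, best))) s"
proof -
  obtain \<rho> A where s: "s = machine \<rho> A" and state: "search_state (stack @ [\<sigma>], best) \<rho> A"
    using assms by (auto simp: loop_inv_def)
  have inv: "search_inv (stack @ [\<sigma>], best)" and bounded: "height_bounded (stack @ [\<sigma>])"
    using assms by (simp_all add: loop_inv_def)
  let ?g = "search_step \<sigma> (stack, best)"
  have "search_inv ?g" using search_inv_step[OF inv] .
  moreover have "height_bounded (fst ?g)" using height_bounded_step[OF _ bounded] inv by simp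
  moreover have "wp W trips (process_node q) (\<lambda>s. \<exists>\<rho> A. s = machine \<rho> A \<and> search_state ?g \<rho> A) s"
    using runs_process_node[OF inv bounded state] by (simp only: runs_def s)
  ultimately show ?thesis unfolding loop_inv_def by (simp only: simp_thms)
qed

lemma loop_inv_final:
  assumes "loop_inv ([], best) s"
  shows "optimum_stored s"
proof -
  have "search_inv ([], best)" using assms by (simp add: loop_inv_def)
  then obtain \<beta> where "best = Some \<beta>" "\<beta> \<in> nodes" "optimal q I (completion \<beta>)"
    by (rule search_inv_final)
  then show ?thesis using assms by (auto simp: loop_inv_def best_stored_def optimum_stored_def)
qed

lemma wp_search:
  assumes init: "loop_inv ([\<sigma>], None) s"
  shows "wp W trips (search q) optimum_stored s"
  unfolding search_def
proof (rule wp_While[where g = "([\<sigma>], None)" and Inv = loop_inv and pot = "\<lambda>g. potential (fst g)"])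
  have "potential [\<sigma>] \<le> branch_base q r ^ length vs * (real (length vs) + 1)"
    using weight_le by (simp add: potential_def)
  then show "potential (fst ([\<sigma>], None)) < real (trips (Reg r_height)) + 1"
    unfolding trips_def max_nodes_def by simp linarith
next
  fix g s assume inv: "loop_inv g s"
  obtain stack best where g: "g = (stack, best)" by (cases g)
  note val = loop_inv_val_height[OF inv[unfolded g]]
  show "fits W s (Reg r_height)" using loop_inv_fits_height inv g by simp
  show "optimum_stored s" if "val s (Reg r_height) = 0" using that val loop_inv_final inv g by simp
  show "wp W trips (process_node q)
      (\<lambda>s'. \<exists>g'. loop_inv g' s' \<and> potential (fst g') + 1 \<le> potential (fst g)) s"
    if "val s (Reg r_height) \<noteq> 0"
  proof -
    have "stack \<noteq> []" using that val by auto
    then obtain below \<tau> where stack: "stack = below @ [\<tau>]" by (cases stack rule: rev_cases) auto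
    then have "\<tau> \<in> nodes" using inv g by (simp add: loop_inv_def)
    then have drop: "potential (fst (search_step \<tau> (below, best))) + 1 \<le> potential (fst g)"
      using potential_step[of \<tau> below best] by (simp only: g stack fst_conv)
    from wp_process_node[OF inv[unfolded g stack]] show ?thesis
      by (rule wp_mono) (use drop in blast)
  qed
qed (use init potential_nonneg in auto)

definition half_output :: "registers \<Rightarrow> matrix \<Rightarrow> (nat \<Rightarrow> nat option) \<Rightarrow> nat \<Rightarrow> ram \<Rightarrow> bool" where
  "half_output \<rho> A \<phi> i s \<longleftrightarrow> agree_below r_index (regs s) \<rho> \<and>
     (\<forall>k<i. mem s k = symbol_code (\<phi> (vs ! k))) \<and> (\<forall>k\<ge>i. mem s k = layout A k)"

lemma half_output_Cell:
  assumes inv: "half_output \<rho> A \<phi> i s" and glob: "globals \<rho>"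
    and i: "i < length vs" "regs s r_index = i" and less: "A 1 (vs ! i) < W"
  shows "val s (Cell VarName (Num 1)) = A 1 (vs ! i)" "fits W s (Cell VarName (Num 1))"
proof -
  let ?v = "vs ! i"
  have rows: "1 < rows" by (simp add: rows_def)
  have v: "?v \<le> M" using Vars_le[OF nth_vs[OF i(1)]] .
  have base: "2 + i < base" using name_less_length_input[OF i(1)] length_input_le by simp
  have name: "mem s (2 + i) = ?v"
    using inv layout_input[OF name_less_length_input[OF i(1)], of A] nth_input_name[OF i(1)]
    by (simp add: half_output_def)
  have "i \<le> addr ?v 1" using base by (simp add: addr_def)
  then have cell: "mem s (addr ?v 1) = A 1 ?v"
    using inv layout_addr[OF rows] by (simp add: half_output_def)
  have regs: "regs s r_rows = rows" "regs s r_base = base"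
    using inv glob by (simp_all add: half_output_def globals_def)
  show "val s (Cell VarName (Num 1)) = A 1 ?v"
    using i(2) name cell regs by (simp add: Cell_def Addr_def VarName_def addr_def)
  show "fits W s (Cell VarName (Num 1))"
    using i(2) name cell regs v base word_limits less addr_less[OF v rows]
    by (simp add: Cell_def Addr_def VarName_def addr_def)
qed

lemma symbol_code_completion:
  assumes "\<beta> \<in> nodes" "v \<in> Vars I"
  shows "symbol_code (completion \<beta> v) = (if node_code (\<beta> v) = q + 1 then 1 else node_code (\<beta> v))"
  using node_code_eq_iff(1)[OF assms(1), of None v] assms(2)
  by (auto simp: completion_def wvalues_def split: option.split)

lemma wp_write_output:
  assumes glob: "globals \<rho>" and \<beta>: "\<beta> \<in> nodes" "stored A 1 \<beta>"
  shows "wp W trips (write_output q) (\<lambda>s. output_represents vs s (completion \<beta>)) (machine \<rho> A)"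
  unfolding write_output_def
proof (rule wp_For[where Inv = "half_output \<rho> A (completion \<beta>)" and k = "length vs"])
  fix i s
  assume i: "i < length vs" "regs s r_index = i" and inv: "half_output \<rho> A (completion \<beta>) i s"
  have v: "vs ! i \<in> Vars I" using nth_vs[OF i(1)] .
  then have code: "A 1 (vs ! i) = node_code (\<beta> (vs ! i))" using \<beta>(2) by (simp add: stored_def)
  note cell = half_output_Cell[OF inv glob i, unfolded code, OF node_code_less[OF \<beta>(1)]]
  have "i < W" using i(1) vars_less_word by (rule less_trans)
  then show "wp W trips (write_value q) (\<lambda>s'. regs s' r_index = i \<and>
      half_output \<rho> A (completion \<beta>) (Suc i) (s'\<lparr>regs := (regs s')(r_index := Suc i)\<rparr>)) s"
    using i inv cell symbol_code_completion[OF \<beta>(1) v]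
    by (auto simp: write_value_def half_output_def less_Suc_eq)
next
  fix s assume "half_output \<rho> A (completion \<beta>) (length vs) s"
  then show "output_represents vs s (completion \<beta>)"
    by (simp add: half_output_def output_represents_def symbol_code_def)
qed (use glob word_limits in \<open>auto simp: half_output_def globals_def trips_def max_trips_def\<close>)

lemma wp_wcsp_solver:
  "wp W trips (wcsp_solver q r) (\<lambda>s. \<exists>\<phi>. optimal q I \<phi> \<and> output_represents vs s \<phi>) (initial input)"
    (is "wp _ _ _ ?Q _")
  unfolding wcsp_solver_def initial_input
proof (rule wp_SeqI[OF runs_push_root[unfolded runs_def]])
  fix s assume "\<exists>\<rho> A. s = machine \<rho> A \<and> search_state ([Map.empty], None) \<rho> A"
  then have "loop_inv ([Map.empty], None) s"
    using search_inv_init height_bounded_singleton by (simp add: loop_inv_def)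
  then show "wp W trips (search q ;; write_output q) ?Q s"
  proof (rule wp_SeqI[OF wp_search])
    fix s assume "optimum_stored s"
    then obtain \<rho> A \<beta> where s: "s = machine \<rho> A" and \<beta>: "globals \<rho>" "\<beta> \<in> nodes" "stored A 1 \<beta>"
      and opt: "optimal q I (completion \<beta>)" unfolding optimum_stored_def by blast
    from wp_write_output[OF \<beta>] show "wp W trips (write_output q) ?Q s"
      unfolding s by (rule wp_mono) (use opt in blast)
  qed
qed

section \<open>Running time\<close>

lemma length_cs_le: "length cs \<le> (length vs + 1) ^ r"
proof -
  have "card (set cs) \<le> (card (Vars I) + 1) ^ r"
    using constraint_subset constraint_card by (intro card_small_subsets_le) (auto simp: set_cs)
  then show ?thesis using distinct_card[OF distinct_cs] by (simp add: length_vs)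
qed

lemma max_trips_le: "max_trips \<le> (length vs + 1) ^ r * (2 + r + table_bound)"
proof -
  let ?N = "(length vs + 1) ^ r"
  have "length vs + 1 \<le> ?N" using power_increasing[of 1 r "length vs + 1"] r_pos by simp
  moreover have "r + table_bound \<le> ?N * (r + table_bound)" by simp
  ultimately have "max_trips \<le> ?N + ?N + ?N * (r + table_bound)"
    unfolding max_trips_def using length_cs_le by linarith
  also have "\<dots> = ?N * (2 + r + table_bound)" by (simp add: algebra_simps)
  finally show ?thesis .
qed

lemma trips_le:
  assumes "p \<in> {push_root q r, process_node q, write_output q}" "e \<in> guards p"
  shows "trips e \<le> max_trips"
  using assms
  by (auto simp: push_root_def mark_free_def process_node_def pop_node_def scan_constraints_def
      scan_constraint_def load_constraint_def multiply_size_def scan_table_def scan_entry_def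
      write_refinement_def write_digit_def push_compatible_def finish_constraint_def
      skip_constraint_def finish_node_def
      count_wildcards_def count_wildcard_def update_best_def copy_row_def write_output_def
      write_value_def trips_def)

lemma time_bound_wcsp_solver_le:
  "time_bound trips (wcsp_solver q r) \<le> (max_nodes + 1) *
     (time_bound (\<lambda>_. 1) (wcsp_solver q r) * max_trips ^ loop_depth (wcsp_solver q r))"
proof -
  define X where "X = max_trips ^ loop_depth (wcsp_solver q r)"
  let ?t = "time_bound (\<lambda>_. 1)"
  have trips: "max_trips \<ge> 1" using r_pos by (simp add: max_trips_def)
  have part: "time_bound trips p \<le> ?t p * X"
    if p: "p \<in> {push_root q r, process_node q, write_output q}" for p
  proof -
    have "time_bound trips p \<le> ?t p * max_trips ^ loop_depth p"
      using trips_le[OF p] trips by (rule time_bound_le)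
    also have "loop_depth p \<le> loop_depth (wcsp_solver q r)"
      using p by (auto simp: wcsp_solver_def search_def)
    then have "?t p * max_trips ^ loop_depth p \<le> ?t p * X"
      unfolding X_def using trips by (intro mult_le_mono2 power_increasing)
    finally show ?thesis .
  qed
  have "X \<ge> 1" unfolding X_def using trips by (rule one_le_power)
  then have "max_nodes * (2 + time_bound trips (process_node q)) \<le>
      max_nodes * ((2 + ?t (process_node q)) * X)"
    using part[of "process_node q"] by (intro mult_le_mono2) (simp add: add_mult_distrib)
  then have "time_bound trips (wcsp_solver q r) \<le> 4 * X + ?t (push_root q r) * X +
      ?t (write_output q) * X + max_nodes * ((2 + ?t (process_node q)) * X)"
    using part[of "push_root q r"] part[of "write_output q"] \<open>X \<ge> 1\<close>
    by (simp add: wcsp_solver_def search_def trips_def)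
  also have "\<dots> \<le> (max_nodes + 1) * (?t (wcsp_solver q r) * X)"
    by (simp add: wcsp_solver_def search_def algebra_simps)
  finally show ?thesis by (simp add: X_def)
qed

end

definition time_factor :: "nat \<Rightarrow> nat \<Rightarrow> nat" where
  "time_factor q r = 2 * time_bound (\<lambda>_. 1) (wcsp_solver q r) *
     (2 + r + (q + 1) ^ r) ^ loop_depth (wcsp_solver q r)"

definition time_degree :: "nat \<Rightarrow> nat \<Rightarrow> nat" where
  "time_degree q r = r * loop_depth (wcsp_solver q r) + 1"

definition word_exponent :: "nat \<Rightarrow> nat \<Rightarrow> nat" where
  "word_exponent q r = ((q + 1) ^ r + q + r + 9) * 4"

lemma (in wcsp_ram) time_wcsp_solver_le:
  "real (time_bound trips (wcsp_solver q r)) \<le> branch_base q r ^ length vs *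
     (real (time_factor q r) * real (length vs + 1) ^ time_degree q r)"
proof -
  let ?b = "branch_base q r ^ length vs" and ?N = "length vs + 1"
  let ?t = "time_bound (\<lambda>_. 1) (wcsp_solver q r)" and ?K = "2 + r + table_bound"
  let ?d = "loop_depth (wcsp_solver q r)"
  have b: "1 \<le> ?b" using branch_base_ge_1[OF q_pos r_pos] by (rule one_le_power)
  then have "1 * 1 \<le> ?b * real ?N" by (intro mult_mono) auto
  moreover have "real max_nodes \<le> ?b * real ?N"
    unfolding max_nodes_def using b by (simp add: add.commute)
  ultimately have search: "real (max_nodes + 1) \<le> 2 * (?b * real ?N)" by simp
  have "max_trips ^ ?d \<le> (?N ^ r * ?K) ^ ?d" using max_trips_le by (rule power_mono) simp
  also have "\<dots> = ?N ^ (r * ?d) * ?K ^ ?d" by (simp only: power_mult_distrib power_mult)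
  finally have overhead: "real (?t * max_trips ^ ?d) \<le> real (?t * (?N ^ (r * ?d) * ?K ^ ?d))"
    by (intro of_nat_mono mult_le_mono2)
  have "real (time_bound trips (wcsp_solver q r)) \<le>
      real (max_nodes + 1) * real (?t * max_trips ^ ?d)"
    using time_bound_wcsp_solver_le by (metis of_nat_le_iff of_nat_mult)
  also have "\<dots> \<le> (2 * (?b * real ?N)) * real (?t * (?N ^ (r * ?d) * ?K ^ ?d))"
    by (rule mult_mono[OF search overhead]) (use b in auto)
  finally show ?thesis by (simp add: time_factor_def time_degree_def table_bound_def mult_ac)
qed

lemma wcsp_ram_word_bound:
  assumes enum: "wcsp_enumeration q r I vs cs" and xs: "xs = encode q I vs cs"
  shows "wcsp_ram q r I vs cs (word_bound (word_exponent q r) k xs) (Max (set xs))"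
proof -
  define c where "c = (q + 1) ^ r + q + r + 8"
  have exponent: "word_exponent q r = (c + 1) * 4" by (simp add: word_exponent_def c_def)
  have "(Max (set xs) + c) ^ 4 \<le> ((Max (set xs) + 2) ^ (c + 1)) ^ 4"
    by (intro power_mono add_le_power) simp
  also have "\<dots> = (Max (set xs) + 2) ^ ((c + 1) * 4)" by (rule power_mult[symmetric])
  also have "\<dots> \<le> (2 ^ k * (Max (set xs) + 2)) ^ ((c + 1) * 4)"
    using mult_le_mono1[of 1 "2 ^ k" "Max (set xs) + 2"] by (intro power_mono) simp_all
  also have "\<dots> = word_bound (word_exponent q r) k xs" by (simp only: word_bound_def exponent)
  finally have "(Max (set xs) + (q + 1) ^ r + q + r + 8) ^ 4 \<le> word_bound (word_exponent q r) k xs"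
    by (simp only: c_def add.assoc)
  moreover have "x \<le> Max (set xs)" if "x \<in> set xs" for x using that by simp
  ultimately show ?thesis
    using enum xs unfolding wcsp_ram_def wcsp_ram_axioms_def by blast
qed

lemma solves_wcsp_in_time_wcsp_solver:
  assumes "q \<ge> 1" "r \<ge> 1"
  shows "solves_wcsp_in_time (wcsp_solver q r) (word_exponent q r) q r
    (\<lambda>n. branch_base q r ^ n * (real (time_factor q r) * real (n + 1) ^ time_degree q r))"
    (is "solves_wcsp_in_time ?p ?k q r ?T")
  unfolding solves_wcsp_in_time_def
proof (intro allI impI, elim conjE)
  fix I vs xs assume inst: "wcsp_instance q r I" and enc: "input_encoding q I vs xs"
  obtain cs where
    cs: "distinct vs" "set vs = Vars I" "distinct cs" "set cs = set_mset (Constraints I)"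
    and xs: "xs = encode q I vs cs"
    using enc unfolding input_encoding_def by blast
  let ?W = "word_bound ?k (card (Vars I)) xs"
  have "wcsp_enumeration q r I vs cs" using assms inst cs by unfold_locales
  then interpret wcsp_ram q r I vs cs ?W "Max (set xs)" using xs by (rule wcsp_ram_word_bound)
  obtain t s where run: "exec ?W ?p (initial xs) t s" "t \<le> time_bound trips ?p"
    and opt: "\<exists>\<phi>. optimal q I \<phi> \<and> output_represents vs s \<phi>"
    using wp_sound[OF wp_wcsp_solver] unfolding input_def xs[symmetric] by blast
  have "real t \<le> ?T (card (Vars I))"
    using run(2) time_wcsp_solver_le unfolding length_vs by (meson of_nat_mono order_trans)
  then show "\<exists>t s \<phi>. exec ?W ?p (initial xs) t s \<and> real t \<le> ?T (card (Vars I)) \<and>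
      optimal q I \<phi> \<and> output_represents vs s \<phi>"
    using run(1) opt by blast
qed

theorem theorem7p4:
  fixes q r :: nat
  assumes "q \<ge> 1" and "r \<ge> 1"
  shows "\<exists>p k c d. solves_wcsp_in_time p k q r
           (\<lambda>n. ((real q + 1) ^ r - 1) powr (real n / real r) * (real c * real (n + 1) ^ d))"
  using solves_wcsp_in_time_wcsp_solver[OF assms] unfolding branch_base_power[OF assms] by blast

end
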